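(* Let $\Psi$ be an Orlicz function and $\phi\colon\mathbb D\to\mathbb D$ analytic. If $C_\phi\colon H^\Psi\to H^\Psi$ is order bounded (into $L^\Psi(\mathbb T)$), then there is $A>0$ with $m(1-|\phi^*|<\lambda)=O\big(1/\chi_A(1/\lambda)\big)$ as $\lambda\to0$; if it is order bounded into $M^\Psi(\mathbb T)$, then $m(1-|\phi^*|<\lambda)=O\big(1/\chi_A(1/\lambda)\big)$ as $\lambda\to0$ for every $A>0$. If moreover $\Psi$ satisfies $\Delta^1$, the converses hold: the first condition (for some $A$) implies order boundedness, and the second (for every $A$) implies order boundedness into $M^\Psi(\mathbb T)$.
   Context: An Orlicz function is a continuous, strictly convex, increasing $\Psi\colon[0,\infty)\to[0,\infty)$ with $\Psi(0)=0$ and $\Psi(x)/x\to\infty$. On $\mathbb T$ with normalized measure $m$: $\|g\|_\Psi=\inf\{C>0:\int\Psi(|g|/C)\,dm\le1\}$, $L^\Psi(\mathbb T)$ its space, $M^\Psi(\mathbb T)$ the subspace with $\int\Psi(|g|/C)\,dm<\infty$ for all $C>0$. $H^\Psi$ = analytic $f$ on $\mathbb D$ with $\sup_{r<1}\|f(re^{i\cdot})\|_\Psi<\infty$, normed by its boundary function $f^*$. $C_\phi f=f\circ\phi$. $C_\phi$ is order bounded (resp. into $M^\Psi(\mathbb T)$) if there is $g\ge0$ in $L^\Psi(\mathbb T)$ (resp. $M^\Psi(\mathbb T)$) with $|(f\circ\phi)^*|\le g$ a.e. for every $f$ in the unit ball of $H^\Psi$. $\chi_A(x)=\Psi(A\Psi^{-1}(x))$.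 $\Delta^1$: there is $\beta>1$ with $x\Psi(x)\le\Psi(\beta x)$ for all large $x$. *)

theory Defs
  imports "HOL-Analysis.Analysis" "HOL-Library.Landau_Symbols"
begin

definition orlicz_function :: "(real \<Rightarrow> real) \<Rightarrow> bool" where
  "orlicz_function Psi \<longleftrightarrow>
     continuous_on {0..} Psi \<and>
     (\<forall>x\<in>{0..}. \<forall>y\<in>{0..}. \<forall>u\<in>{0<..<1}. x \<noteq> y \<longrightarrow>
         Psi ((1 - u) * x + u * y) < (1 - u) * Psi x + u * Psi y) \<and>
     strict_mono_on {0..} Psi \<and>
     Psi 0 = 0 \<and>
     filterlim (\<lambda>x. Psi x / x) at_top at_top"

text \<open>The circle T is parametrised by t in [0, 2 pi] via cis t; normalized Lebesgue measure m.\<close>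
definition circ_meas :: "real measure" where
  "circ_meas = uniform_measure lborel {0..2*pi}"

definition orlicz_modular :: "(real \<Rightarrow> real) \<Rightarrow> (real \<Rightarrow> complex) \<Rightarrow> ennreal" where
  "orlicz_modular Psi g = (\<integral>\<^sup>+ t. ennreal (Psi (norm (g t))) \<partial>circ_meas)"

definition lux_norm :: "(real \<Rightarrow> real) \<Rightarrow> (real \<Rightarrow> complex) \<Rightarrow> real" where
  "lux_norm Psi g = Inf {C. C > 0 \<and> orlicz_modular Psi (\<lambda>t. g t / of_real C) \<le> 1}"

definition in_LPsi :: "(real \<Rightarrow> real) \<Rightarrow> (real \<Rightarrow> complex) \<Rightarrow> bool" where
  "in_LPsi Psi g \<longleftrightarrow> g \<in> borel_measurable circ_meas \<and>
     (\<exists>C>0. orlicz_modular Psi (\<lambda>t. g t / of_real C) \<le> 1)"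

definition in_MPsi :: "(real \<Rightarrow> real) \<Rightarrow> (real \<Rightarrow> complex) \<Rightarrow> bool" where
  "in_MPsi Psi g \<longleftrightarrow> g \<in> borel_measurable circ_meas \<and>
     (\<forall>C>0. orlicz_modular Psi (\<lambda>t. g t / of_real C) < \<infinity>)"

text \<open>Boundary function f^*: the radial limit (exists a.e. for the functions considered).\<close>
definition boundary_fun :: "(complex \<Rightarrow> complex) \<Rightarrow> real \<Rightarrow> complex" where
  "boundary_fun f t = Lim (at_left 1) (\<lambda>r::real. f (of_real r * cis t))"

definition in_HPsi :: "(real \<Rightarrow> real) \<Rightarrow> (complex \<Rightarrow> complex) \<Rightarrow> bool" where
  "in_HPsi Psi f \<longleftrightarrow> f holomorphic_on ball 0 1 \<and>
     (\<exists>K. \<forall>r\<in>{0<..<1}. in_LPsi Psi (\<lambda>t. f (of_real r * cis t)) \<and>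
                         lux_norm Psi (\<lambda>t. f (of_real r * cis t)) \<le> K)"

definition HPsi_unit_ball :: "(real \<Rightarrow> real) \<Rightarrow> (complex \<Rightarrow> complex) set" where
  "HPsi_unit_ball Psi = {f. in_HPsi Psi f \<and> in_LPsi Psi (boundary_fun f) \<and>
                              lux_norm Psi (boundary_fun f) \<le> 1}"

definition order_bounded :: "(real \<Rightarrow> real) \<Rightarrow> (complex \<Rightarrow> complex) \<Rightarrow> bool" where
  "order_bounded Psi phi \<longleftrightarrow> (\<exists>g::real \<Rightarrow> real. (\<forall>t. g t \<ge> 0) \<and>
     in_LPsi Psi (\<lambda>t. of_real (g t)) \<and>
     (\<forall>f\<in>HPsi_unit_ball Psi. AE t in circ_meas. norm (boundary_fun (f \<circ> phi) t) \<le> g t))"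

definition order_bounded_M :: "(real \<Rightarrow> real) \<Rightarrow> (complex \<Rightarrow> complex) \<Rightarrow> bool" where
  "order_bounded_M Psi phi \<longleftrightarrow> (\<exists>g::real \<Rightarrow> real. (\<forall>t. g t \<ge> 0) \<and>
     in_MPsi Psi (\<lambda>t. of_real (g t)) \<and>
     (\<forall>f\<in>HPsi_unit_ball Psi. AE t in circ_meas. norm (boundary_fun (f \<circ> phi) t) \<le> g t))"

definition chi :: "(real \<Rightarrow> real) \<Rightarrow> real \<Rightarrow> real \<Rightarrow> real" where
  "chi Psi A x = Psi (A * the_inv_into {0..} Psi x)"

definition Delta1 :: "(real \<Rightarrow> real) \<Rightarrow> bool" where
  "Delta1 Psi \<longleftrightarrow> (\<exists>\<beta>>1. \<forall>\<^sub>F x in at_top. x * Psi x \<le> Psi (\<beta> * x))"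

definition carleson_cond :: "(real \<Rightarrow> real) \<Rightarrow> (complex \<Rightarrow> complex) \<Rightarrow> real \<Rightarrow> bool" where
  "carleson_cond Psi phi A \<longleftrightarrow>
     (\<lambda>l. measure circ_meas {t. 1 - norm (boundary_fun phi t) < l})
       \<in> O[at_right 0](\<lambda>l. 1 / chi Psi A (1 / l))"

end

theory Submission
  imports Defs "HOL-Complex_Analysis.Cauchy_Integral_Formula"
begin

text \<open>
  Necessity: a function \<open>g\<close> dominating the image of the unit ball dominates \<open>(f \<circ> \<phi>)*\<close> for the test functions
  \<open>f = \<Psi>\<^sup>-\<^sup>1(1/l) * (l / (1 - (1 - l) * cis (-s) * z))\<^sup>2\<close>, \<open>s\<close> rational, which have norm at most 1.  Choosing
  \<open>s\<close> close to the argument of \<open>\<phi>*\<close> gives \<open>g \<ge> \<Psi>\<^sup>-\<^sup>1(1/l) / 9\<close> on the set \<open>1 - \<bar>\<phi>*\<bar> < l\<close>, and Markov's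
  inequality for \<open>\<Psi>(9 A g)\<close> is the Carleson-type condition.

  Sufficiency: the Poisson formula gives \<open>\<bar>f z\<bar> \<le> 6 * \<Psi>\<^sup>-\<^sup>1(1/(1 - \<bar>z\<bar>))\<close> for \<open>f\<close> in the unit ball, so
  \<open>6 * \<Psi>\<^sup>-\<^sup>1(1/(1 - \<bar>\<phi>*\<bar>))\<close> dominates; under \<open>\<Delta>\<^sup>1\<close> the Carleson-type condition makes its \<open>\<Psi>\<close>-modular finite.

  Both directions need radial limits almost everywhere.  As \<open>\<Delta>\<^sup>1\<close> forces \<open>H\<^sup>\<Psi> \<subseteq> H\<^sup>2\<close>, Fatou's theorem in
  \<open>H\<^sup>2\<close> suffices, and it follows from an \<open>L\<^sup>2\<close> maximal inequality by approximation with Taylor polynomials.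
\<close>

section \<open>The circle and the Poisson kernel\<close>

text \<open>Three obstacles shape the argument. Domination holds outside a null set that depends on
  f, while the argument of the boundary value of \<open>phi\<close> ranges over a continuum; so only
  countably many directions can be tested at once, and a nearby direction costs 9 = 3^2, where 3 l
  bounds the denominator of the test function. Next, members of the unit ball have radial limits
  only almost everywhere, so the Poisson formula must be carried from dilates to boundary values;
  the H^2 bound controls the truncation error in that limit. The constant 6 is 2 + 4: with y =
  \<open>Inv (1 / (1 - norm z))\<close>, boundary values up to 2 y contribute 2 y, the larger ones
  at most 4 y by convexity; both contain a factor 2 because the infimum defining the norm is used
  only through larger constants. Finally, the Carleson-type condition is a weak-type estimate, which
  at the same scale need not give an integrable \<open>Psi\<close> of the envelope.
  \<open>Delta1\<close> gains a factor x when the argument is rescaled by its constant, and this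
  gain makes a dyadic sum converge.\<close>

lemma sets_circ_meas [measurable_cong, simp]: "sets circ_meas = sets borel"
  by (simp add: circ_meas_def)

lemma space_circ_meas [simp]: "space circ_meas = UNIV"
  by (simp add: circ_meas_def)

lemma circ_meas_density:
  "circ_meas = density lborel (\<lambda>t. ennreal (indicator {0..2*pi} t / (2*pi)))"
proof -
  have "emeasure lborel {0..2*pi} = ennreal (2*pi)"
    by simp
  moreover have "indicator A t / ennreal (2*pi) = ennreal (indicator A t / (2*pi))" for A :: "real set" and t
    using divide_ennreal[of "indicator A t" "2*pi"] by (simp add: ennreal_indicator)
  ultimately show ?thesis
    unfolding circ_meas_def uniform_measure_def by (simp only:)
qed

lemma emeasure_circ_UNIV: "emeasure circ_meas UNIV = 1"
  unfolding circ_meas_def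
  by (subst emeasure_uniform_measure) (auto simp: ennreal_divide_self)

global_interpretation circ: finite_measure circ_meas
  by standard (simp add: emeasure_circ_UNIV)

lemma measure_circ_UNIV [simp]: "measure circ_meas UNIV = 1"
  by (simp add: measure_def emeasure_circ_UNIV)

lemma circ_integrable_bounded:
  fixes F :: "real \<Rightarrow> 'a::{banach, second_countable_topology}"
  assumes "F \<in> borel_measurable borel" "\<And>t. norm (F t) \<le> B"
  shows "integrable circ_meas F"
  using assms by (intro circ.integrable_const_bound[where B=B]) auto

lemma circ_integral_eq:
  fixes F :: "real \<Rightarrow> complex"
  assumes F: "continuous_on UNIV F" and I: "(F has_integral I) {0..2*pi}"
  shows "integral\<^sup>L circ_meas F = I / (2*pi)"
proof -
  have [measurable]: "F \<in> borel_measurable borel"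
    using F by (rule borel_measurable_continuous_onI)
  have "integral\<^sup>L circ_meas F = (\<integral>t. (indicator {0..2*pi} t / (2*pi)) *\<^sub>R F t \<partial>lborel)"
    unfolding circ_meas_density
    by (subst integral_density) auto
  also have "\<dots> = (\<integral>t. (1/(2*pi)) *\<^sub>R (indicator {0..2*pi} t *\<^sub>R F t) \<partial>lborel)"
    by (rule Bochner_Integration.integral_cong) auto
  also have "\<dots> = (1/(2*pi)) *\<^sub>R (LINT t:{0..2*pi}|lborel. F t)"
    unfolding set_lebesgue_integral_def by (rule integral_scaleR_right)
  also have "(LINT t:{0..2*pi}|lborel. F t) = I"
    using set_borel_integral_eq_integral(2)[OF borel_integrable_atLeastAtMost', of 0 "2*pi" F]
      integral_unique[OF I] continuous_on_subset[OF F] by auto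
  finally show ?thesis by (simp add: scaleR_conv_of_real)
qed

text \<open>Parametrizing by \<open>cis t\<close> turns dw into i \<open>cis t\<close> dt, whence
  the extra factor \<open>cis t\<close>. The radius exceeds 1 because functions on the open disc
  reach the unit circle only through dilates, which are analytic past it.\<close>

lemma circ_cauchy:
  assumes F: "F holomorphic_on ball 0 \<rho>" and "\<rho> > 1" and z: "norm z < 1"
  shows "(\<integral>t. F (cis t) * cis t / (cis t - z) \<partial>circ_meas) = F z"
proof -
  have cb: "cball 0 1 \<subseteq> ball (0::complex) \<rho>"
    using \<open>\<rho> > 1\<close> by auto
  have ne: "cis t \<noteq> z" for t
    using z by auto
  have contF: "continuous_on (ball 0 \<rho>) F"
    using F by (rule holomorphic_on_imp_continuous_on)
  have "((\<lambda>u. F u/(u-z)) has_contour_integral (2 * of_real pi * \<i> * F z)) (circlepath 0 1)"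
    using z by (intro Cauchy_integral_circlepath_simple holomorphic_on_subset[OF F] cb) auto
  then have "((\<lambda>t. F (cis t) / (cis t - z) * \<i> * cis t) has_integral (2 * of_real pi * \<i> * F z)) {0..2*pi}"
    unfolding circlepath_def by (subst (asm) has_contour_integral_part_circlepath_iff) auto
  then have "((\<lambda>t. F (cis t) / (cis t - z) * \<i> * cis t * (-\<i>)) has_integral (2 * of_real pi * \<i> * F z * (-\<i>))) {0..2*pi}"
    by (rule has_integral_mult_left)
  moreover have "F (cis t) / (cis t - z) * \<i> * cis t * (-\<i>) = F (cis t) * cis t / (cis t - z)" for t
  proof -
    have "F (cis t) / (cis t - z) * \<i> * cis t * (-\<i>) = F (cis t) / (cis t - z) * cis t * (\<i> * (-\<i>))"
      by (simp only: mult_ac)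
    then show ?thesis by simp
  qed
  moreover have "2 * of_real pi * \<i> * F z * (-\<i>) = 2 * of_real pi * F z"
    by simp
  ultimately have *: "((\<lambda>t. F (cis t) * cis t / (cis t - z)) has_integral (2 * of_real pi * F z)) {0..2*pi}"
    by (simp only:)
  have "continuous_on UNIV (\<lambda>t. F (cis t) * cis t / (cis t - z))"
    using cb ne by (intro continuous_intros continuous_on_compose2[OF contF]) auto
  from circ_integral_eq[OF this *] show ?thesis by simp
qed

corollary circ_mean:
  assumes "F holomorphic_on ball 0 \<rho>" and "\<rho> > 1"
  shows "(\<integral>t. F (cis t) \<partial>circ_meas) = F 0"
  using circ_cauchy[OF assms, of 0] by simp

text \<open>The mean value property gives the nonnegative frequencies and conjugation the negative
  ones; the split at \<open>m \<le> n\<close> keeps the exponents natural numbers.\<close>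

lemma circ_ortho: "(\<integral>t. cis (real n * t) * cis (- (real m * t)) \<partial>circ_meas) = (if n = m then 1 else 0)"
proof -
  have pos: "(\<integral>t. cis (real k * t) \<partial>circ_meas) = (if k = 0 then 1 else 0)" for k
  proof -
    have "(\<integral>t. cis t ^ k \<partial>circ_meas) = 0 ^ k"
      by (rule circ_mean[of "\<lambda>z. z ^ k" 2]) (auto intro: holomorphic_intros)
    then show ?thesis
      unfolding Complex.DeMoivre by (simp add: power_0_left)
  qed
  have neg: "(\<integral>t. cis (- (real k * t)) \<partial>circ_meas) = (if k = 0 then 1 else 0)" for k
  proof -
    have "(\<integral>t. cis (- (real k * t)) \<partial>circ_meas) = (\<integral>t. cnj (cis (real k * t)) \<partial>circ_meas)"
      by (simp only: cis_cnj)
    also have "\<dots> = cnj (\<integral>t. cis (real k * t) \<partial>circ_meas)"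
      by (rule Bochner_Integration.integral_cnj)
    finally show ?thesis by (simp only: pos) auto
  qed
  have eq: "cis (real n * t) * cis (- (real m * t)) =
     (if m \<le> n then cis (real (n - m) * t) else cis (- (real (m - n) * t)))" for t
    by (cases "m \<le> n") (simp_all add: cis_mult of_nat_diff left_diff_distrib)
  show ?thesis
    unfolding eq using pos[of "n - m"] neg[of "m - n"] by (cases "m \<le> n") auto
qed

section \<open>The Poisson kernel: representation, symmetry, semigroup law and comparison of
  radii\<close>

definition poisson :: "complex \<Rightarrow> real \<Rightarrow> real" where
  "poisson z t = (1 - (norm z)\<^sup>2) / (norm (cis t - z))\<^sup>2"

lemma poisson_pos: "norm z < 1 \<Longrightarrow> poisson z t > 0"
  unfolding poisson_def by (intro divide_pos_pos) (auto simp: power_less_one_iff abs_square_less_1)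

lemma poisson_le:
  assumes "norm z < 1" shows "poisson z t \<le> 2 / (1 - norm z)"
proof -
  have "1 - norm z \<le> norm (cis t - z)"
    using norm_triangle_ineq2[of "cis t" z] by simp
  then have "(1 - norm z)\<^sup>2 \<le> (norm (cis t - z))\<^sup>2"
    using assms by (intro power_mono) auto
  then have "poisson z t \<le> (1 - (norm z)\<^sup>2) / (1 - norm z)\<^sup>2"
    unfolding poisson_def using assms
    by (intro divide_left_mono mult_pos_pos) (auto simp: abs_square_le_1 zero_less_power2)
  also have "\<dots> = (1 + norm z) / (1 - norm z)"
    using assms by (simp add: power2_eq_square divide_simps) (simp add: algebra_simps)
  also have "\<dots> \<le> 2 / (1 - norm z)"
    using assms by (intro divide_right_mono) auto
  finally show ?thesis .
qed

lemma borel_measurable_cis [measurable]: "cis \<in> borel_measurable borel"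
  by (intro borel_measurable_continuous_onI continuous_intros)

lemma borel_measurable_poisson [measurable (raw)]:
  assumes [measurable]: "f \<in> borel_measurable M" "g \<in> borel_measurable M"
  shows "(\<lambda>x. poisson (f x) (g x)) \<in> borel_measurable M"
  unfolding poisson_def by measurable

lemma circ_poisson:
  fixes F :: "complex \<Rightarrow> complex"
  assumes F: "F holomorphic_on ball 0 \<rho>" and "\<rho> > 1" and z: "norm z < 1"
  shows "(\<integral>t. poisson z t * F (cis t) \<partial>circ_meas) = F z"
proof -
  \<comment> \<open>The pole of \<open>G\<close> below has modulus \<open>1 / norm z\<close> and
    must stay outside the disc. For \<open>z = 0\<close> there is no pole, and
    \<open>1 / 0 = 0\<close> would be a useless radius, so 2 takes its place.\<close>
  define \<sigma> where "\<sigma> = min \<rho> (if z = 0 then 2 else 1 / norm z)"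
  have "\<sigma> > 1" using assms by (auto simp: \<sigma>_def)
  have nz: "1 - cnj z * w \<noteq> 0" if "norm w < \<sigma>" for w
  proof
    assume "1 - cnj z * w = 0"
    then have "norm (cnj z * w) = 1" by (metis eq_iff_diff_eq_0 norm_one)
    then have "norm z * norm w = 1" by (simp add: norm_mult)
    moreover from this have "z \<noteq> 0" by auto
    ultimately show False using that by (auto simp: \<sigma>_def field_simps)
  qed
  \<comment> \<open>Cauchy's formula for \<open>G\<close> at \<open>z\<close>: on the circle \<open>(1 - cnj z * w) * (w - z) = w * \<bar>w - z\<bar>\<^sup>2\<close>,
    so that the Cauchy kernel becomes the Poisson kernel.\<close>
  define G where "G = (\<lambda>w. F w * of_real (1 - (norm z)\<^sup>2) / (1 - cnj z * w))"
  have "G holomorphic_on ball 0 \<sigma>"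
    unfolding G_def using nz
    by (intro holomorphic_intros holomorphic_on_subset[OF F]) (auto simp: \<sigma>_def)
  from circ_cauchy[OF this \<open>\<sigma> > 1\<close> z]
  have "(\<integral>t. G (cis t) * cis t / (cis t - z) \<partial>circ_meas) = G z" .
  moreover have "G z = F z"
  proof -
    have "of_real (1 - (norm z)\<^sup>2) = 1 - cnj z * z"
      by (simp add: complex_norm_square[symmetric] mult.commute)
    then show ?thesis using nz[of z] z \<open>\<sigma> > 1\<close> by (simp add: G_def)
  qed
  moreover have "G (cis t) * cis t / (cis t - z) = poisson z t * F (cis t)" for t
  proof -
    have e: "1 - cnj z * cis t = cnj (cis t - z) * cis t"
      by (simp add: algebra_simps cis_cnj cis_mult)
    have "cis t \<noteq> z" using z by auto
    then have "G (cis t) * cis t / (cis t - z) = F (cis t) * of_real (1 - (norm z)\<^sup>2) / (cnj (cis t - z) * (cis t - z))"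
      unfolding G_def e by simp
    also have "cnj (cis t - z) * (cis t - z) = of_real ((norm (cis t - z))\<^sup>2)"
      by (simp only: complex_norm_square mult.commute)
    finally show ?thesis by (simp add: poisson_def)
  qed
  ultimately show ?thesis by (simp only:)
qed

lemma integral_poisson:
  assumes "norm z < 1" shows "(\<integral>t. poisson z t \<partial>circ_meas) = 1"
proof -
  have "complex_of_real (\<integral>t. poisson z t \<partial>circ_meas) = (\<integral>t. of_real (poisson z t) \<partial>circ_meas)"
    by simp
  also have "\<dots> = 1"
    using circ_poisson[of "\<lambda>_. 1" 2 z] assms by simp
  finally show ?thesis by (simp only: of_real_eq_1_iff)
qed

lemma nn_integral_poisson:
  assumes "norm z < 1" shows "(\<integral>\<^sup>+t. ennreal (poisson z t) \<partial>circ_meas) = 1"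
  using integral_poisson[OF assms] poisson_pos[OF assms] poisson_le[OF assms]
  by (subst nn_integral_eq_integral)
    (auto intro!: circ_integrable_bounded[where B="2 / (1 - norm z)"] simp: less_imp_le)

text \<open>Conjugation followed by a rotation exchanges the two angles without changing the
  distance. This symmetry lets a kernel with centre and boundary angle interchanged be read as a
  kernel again, as T T* requires.\<close>

lemma poisson_shift: "poisson (of_real r * cis s) t = poisson (of_real r * cis t) s"
proof -
  have "norm (cis t - of_real r * cis s) = norm (cis s - of_real r * cis t)"
  proof -
    have "cis t - of_real r * cis s = cis (t + s) * cnj (cis s - of_real r * cis t)"
      by (simp add: algebra_simps cis_cnj cis_mult)
    then show ?thesis by (simp only: norm_mult complex_mod_cnj norm_cis mult_1)
  qed
  then show ?thesis by (simp add: poisson_def norm_mult)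
qed

lemma poisson_semigroup:
  assumes r: "0 \<le> r" "r < 1" and q: "0 \<le> q" "q < 1"
  shows "(\<integral>u. poisson (of_real r * cis t) u * poisson (of_real q * cis s) u \<partial>circ_meas)
       = poisson (of_real (r * q) * cis t) s"
proof (cases "q = 0")
  \<comment> \<open>Here the kernel of radius 0 is constantly 1, and the radius \<open>1 / q\<close>
    of the other case would degenerate.\<close>
  case True
  then show ?thesis using integral_poisson[of "of_real r * cis t"] r
    by (simp add: poisson_def norm_mult)
next
  case False
  \<comment> \<open>The Poisson kernel is the real part of the analytic function \<open>H\<close>.\<close>
  define H where "H = (\<lambda>w. (1 + of_real q * cis (-s) * w) / (1 - of_real q * cis (-s) * w))"
  have nz: "1 - of_real q * cis (-s) * w \<noteq> 0" if "norm w < 1/q" for w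
  proof
    assume "1 - of_real q * cis (-s) * w = 0"
    then have "norm (of_real q * cis (-s) * w) = 1" by (metis eq_iff_diff_eq_0 norm_one)
    then show False using that q False by (auto simp: norm_mult field_simps)
  qed
  have "H holomorphic_on ball 0 (1/q)"
    unfolding H_def using nz by (intro holomorphic_intros) auto
  then have eq: "(\<integral>u. poisson (of_real r * cis t) u * H (cis u) \<partial>circ_meas) = H (of_real r * cis t)"
    using r q False by (intro circ_poisson[where \<rho>="1/q"]) (auto simp: norm_mult)
  \<comment> \<open>Used with \<open>p = 1\<close>, where it identifies the boundary values of
    \<open>Re H\<close>, and with \<open>p = r\<close>, where it gives the right-hand side.\<close>
  have ReH: "Re (H (of_real p * cis u)) = poisson (of_real (p * q) * cis u) s" if "0 \<le> p" "p \<le> 1" for p u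
  proof -
    define v where "v = of_real q * cis (-s) * (of_real p * cis u)"
    have nv: "norm v = p * q" using that q by (simp add: v_def norm_mult)
    have v1: "norm (1 - v) = norm (cis s - of_real (p*q) * cis u)"
    proof -
      have "cis s - of_real (p*q) * cis u = cis s * (1 - v)"
        by (simp add: v_def algebra_simps cis_mult)
      then show ?thesis by (simp only: norm_mult norm_cis mult_1)
    qed
    have "Re ((1+v)/(1-v)) = (1 - (norm v)\<^sup>2) / (norm (1-v))\<^sup>2"
      unfolding Re_divide cmod_power2 by (simp add: power2_eq_square algebra_simps)
    then show ?thesis
      using that q by (simp add: H_def v_def[symmetric] poisson_def v1 nv norm_mult)
  qed
  have [measurable]: "(\<lambda>u. poisson (of_real r * cis t) u) \<in> borel_measurable borel"
    by measurable
  have contH: "continuous_on UNIV (\<lambda>u. H (cis u))"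
    by (rule continuous_on_compose2[OF holomorphic_on_imp_continuous_on[OF \<open>H holomorphic_on ball 0 (1/q)\<close>]])
      (use q False in \<open>auto intro!: continuous_intros\<close>)
  have "compact ((\<lambda>u. H u) ` sphere 0 1)"
    by (rule compact_continuous_image[OF continuous_on_subset[OF holomorphic_on_imp_continuous_on[OF \<open>H holomorphic_on ball 0 (1/q)\<close>]]])
     (use q False in auto)
  then obtain B where B: "\<And>w. norm w = 1 \<Longrightarrow> norm (H w) \<le> B"
    using compact_imp_bounded bounded_iff by (metis (no_types, lifting) image_eqI mem_sphere_0)
  have int: "integrable circ_meas (\<lambda>u. poisson (of_real r * cis t) u * H (cis u))"
  proof (rule circ_integrable_bounded[where B="2/(1-r) * B"])
    show "norm (poisson (of_real r * cis t) u * H (cis u)) \<le> 2/(1-r) * B" for u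
    proof -
      have "norm (poisson (of_real r * cis t) u) \<le> 2/(1-r)"
        using poisson_le[of "of_real r * cis t" u] poisson_pos[of "of_real r * cis t" u] r
        by (simp add: norm_mult)
      then show ?thesis
        unfolding norm_mult norm_of_real using B[of "cis u"] r
        by (intro mult_mono) auto
    qed
  next
    have [measurable]: "(\<lambda>u. H (cis u)) \<in> borel_measurable borel"
      using contH by (rule borel_measurable_continuous_onI)
    show "(\<lambda>u. complex_of_real (poisson (of_real r * cis t) u) * H (cis u)) \<in> borel_measurable borel"
      by measurable
  qed
  have "(\<integral>u. Re (poisson (of_real r * cis t) u * H (cis u)) \<partial>circ_meas) = Re (H (of_real r * cis t))"
    using integral_Re[OF int] eq by simp
  then show ?thesis
    using ReH[of 1] ReH[of r t] r q by (simp add: poisson_shift[of q])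
qed

text \<open>Shrinking the radius from r to r q with \<open>q \<ge> r\<close> at most doubles the
  numerator, since \<open>1 - r^4 \<le> 2 * (1 - r^2)\<close>. The distance shrinks at most by half:
  the displacement r (1 - q) is at most 1 - r q, hence at most the new distance. Squaring gives 2 *
  4 = 8.\<close>

lemma poisson_dominate:
  assumes "0 \<le> r" "r \<le> q" "q < 1"
  shows "poisson (of_real (r * q) * cis t) s \<le> 8 * poisson (of_real r * cis t) s"
proof -
  define A where "A = norm (cis s - of_real r * cis t)"
  define B where "B = norm (cis s - of_real (r*q) * cis t)"
  have rq: "r * q \<le> r" using assms by (simp add: mult_left_le)
  have "cis s - of_real r * cis t = (cis s - of_real (r*q) * cis t) - of_real (r * (1 - q)) * cis t"
    by (simp add: algebra_simps)
  then have "A \<le> B + norm (of_real (r * (1 - q)) * cis t)"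
    unfolding A_def B_def by (metis norm_triangle_ineq4)
  also have "norm (of_real (r * (1 - q)) * cis t) = r * (1 - q)"
    using assms by (simp only: norm_mult norm_of_real norm_cis) simp
  also have "r * (1 - q) \<le> 1 - r * q" using assms by (simp add: algebra_simps)
  also have "1 - r * q \<le> B"
    unfolding B_def using norm_triangle_ineq2[of "cis s" "of_real (r*q) * cis t"] assms
    by (simp add: norm_mult)
  finally have AB: "A \<le> 2 * B" by simp
  have "1 - r \<le> A"
    unfolding A_def using norm_triangle_ineq2[of "cis s" "of_real r * cis t"] assms
    by (simp add: norm_mult)
  then have "A > 0" using assms by simp
  then have "B > 0" using AB by simp
  have "r^4 \<le> (r*q)\<^sup>2"
  proof -
    have "r * r \<le> r * q" using assms by (intro mult_left_mono) auto
    then have "(r*r)\<^sup>2 \<le> (r*q)\<^sup>2" using assms by (intro power_mono) auto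
    then show ?thesis by (simp add: power2_eq_square power4_eq_xxxx mult.assoc)
  qed
  then have "1 - (r*q)\<^sup>2 \<le> 1 - r^4" by simp
  also have "\<dots> = (1 - r\<^sup>2) * (1 + r\<^sup>2)" by (simp add: algebra_simps power2_eq_square power4_eq_xxxx)
  also have "\<dots> \<le> (1 - r\<^sup>2) * 2"
    using assms by (intro mult_left_mono) (auto simp: abs_square_le_1)
  finally have num: "1 - (r*q)\<^sup>2 \<le> 2 * (1 - r\<^sup>2)" by simp
  have r2: "1 - r\<^sup>2 \<ge> 0" using assms by (auto simp: abs_square_le_1)
  have "A\<^sup>2 \<le> (2*B)\<^sup>2" using AB \<open>A > 0\<close> by (intro power_mono) auto
  then have "1 / B\<^sup>2 \<le> 4 / A\<^sup>2" using \<open>A > 0\<close> \<open>B > 0\<close> by (simp add: divide_simps power2_eq_square)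
  then have "(1 - (r*q)\<^sup>2) * (1 / B\<^sup>2) \<le> (2 * (1 - r\<^sup>2)) * (4 / A\<^sup>2)"
    using num r2 by (intro mult_mono) auto
  then show ?thesis using assms by (simp add: poisson_def A_def B_def norm_mult)
qed

section \<open>The radial maximal inequality\<close>

lemma circ_Fubini:
  fixes f :: "real \<Rightarrow> real \<Rightarrow> real"
  assumes [measurable]: "case_prod f \<in> borel_measurable (borel \<Otimes>\<^sub>M borel)" and "\<And>x y. \<bar>f x y\<bar> \<le> B"
  shows "(\<integral>y. (\<integral>x. f x y \<partial>circ_meas) \<partial>circ_meas) = (\<integral>x. (\<integral>y. f x y \<partial>circ_meas) \<partial>circ_meas)"
proof -
  interpret pair_sigma_finite circ_meas circ_meas ..
  interpret P: finite_measure "circ_meas \<Otimes>\<^sub>M circ_meas"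
    by (rule finite_measure_pair_measure) unfold_locales
  have "integrable (circ_meas \<Otimes>\<^sub>M circ_meas) (case_prod f)"
    using assms(2) by (intro P.integrable_const_bound[where B=B]) auto
  then show ?thesis by (rule Fubini_integral)
qed

lemma circ_integral_measurable [measurable (raw)]:
  fixes f :: "real \<Rightarrow> real \<Rightarrow> real"
  assumes [measurable]: "case_prod f \<in> borel_measurable (M \<Otimes>\<^sub>M borel)"
  shows "(\<lambda>x. \<integral>y. f x y \<partial>circ_meas) \<in> borel_measurable M"
proof -
  have "case_prod f \<in> borel_measurable (M \<Otimes>\<^sub>M circ_meas)" by measurable
  then show ?thesis by (rule circ.borel_measurable_lebesgue_integral)
qed

lemma circ_integral_abs_le:
  assumes "\<And>t. \<bar>f t\<bar> \<le> (B::real)"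
  shows "\<bar>\<integral>t. f t \<partial>circ_meas\<bar> \<le> B"
proof (cases "integrable circ_meas f")
  case True
  have "\<bar>\<integral>t. f t \<partial>circ_meas\<bar> \<le> (\<integral>t. \<bar>f t\<bar> \<partial>circ_meas)"
    by (rule integral_abs_bound)
  also have "\<dots> \<le> (\<integral>t. B \<partial>circ_meas)"
    using True assms by (intro integral_mono) auto
  finally show ?thesis by simp
next
  case False
  have "0 \<le> B" using assms[of 0] by (meson abs_ge_zero order_trans)
  then show ?thesis using False by (simp add: not_integrable_integral_eq)
qed

text \<open>
  The linearised maximal operator is \<open>T u t = \<integral> K t s * u s\<close>, where \<open>K t s\<close> is the Poisson
  kernel at the point \<open>r t * cis t\<close> and \<open>r t\<close> is the first radius at which \<open>U\<close> exceeds \<open>\<epsilon>\<close>.  By the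
  semigroup law the kernel of \<open>T T*\<close> at \<open>(t, u)\<close> is the Poisson kernel of radius \<open>r t * r u\<close>, which is at
  most \<open>8 * (K t u + K u t)\<close>.  Hence \<open>w = T* 1\<^sub>E\<close> satisfies \<open>\<integral> w\<^sup>2 \<le> 16 * \<integral> 1\<^sub>E * w\<close>, which bounds
  \<open>\<integral> w\<^sup>2\<close> by \<open>256 * m(E)\<close> without any covering argument.
\<close>
lemma maximal_inequality_finite:
  fixes q :: "nat \<Rightarrow> real" and U :: "complex \<Rightarrow> complex"
  assumes U: "U holomorphic_on ball 0 \<rho>" and \<rho>: "\<rho> > 1"
    and q: "\<And>i. i < n \<Longrightarrow> 0 \<le> q i \<and> q i < 1" and \<epsilon>: "\<epsilon> > 0"
  shows "measure circ_meas {t. \<exists>i<n. norm (U (of_real (q i) * cis t)) > \<epsilon>}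
           \<le> 256 * (\<integral>t. (norm (U (cis t)))\<^sup>2 \<partial>circ_meas) / \<epsilon>\<^sup>2"
proof -
  define E where "E = {t. \<exists>i<n. norm (U (of_real (q i) * cis t)) > \<epsilon>}"
  define P where "P i t \<longleftrightarrow> i < n \<and> norm (U (of_real (q i) * cis t)) > \<epsilon>" for i t
  define k where "k t = (LEAST i. P i t)" for t
  \<comment> \<open>Off \<open>E\<close> the radius defaults to 0; the indicator \<open>I\<close>
    removes these angles from every integral over t.\<close>
  define r where "r t = (if t \<in> E then q (k t) else 0)" for t
  have contU: "continuous_on (ball 0 \<rho>) U"
    using U by (rule holomorphic_on_imp_continuous_on)
  have contUc: "continuous_on UNIV (\<lambda>t. U (of_real p * cis t))" if "0 \<le> p" "p \<le> 1" for p
    using that \<rho> by (intro continuous_on_compose2[OF contU] continuous_intros) (auto simp: norm_mult)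
  have Um: "(\<lambda>t. U (of_real p * cis t)) \<in> borel_measurable borel" if "0 \<le> p" "p \<le> 1" for p
    by (rule borel_measurable_continuous_onI[OF contUc[OF that]])
  have Um1 [measurable]: "(\<lambda>t. U (cis t)) \<in> borel_measurable borel"
    using Um[of 1] by simp
  have [measurable]: "Measurable.pred borel (P i)" for i
  proof (cases "i < n")
    case True
    then have [measurable]: "(\<lambda>t. U (of_real (q i) * cis t)) \<in> borel_measurable borel"
      using q[of i] by (intro Um) auto
    show ?thesis unfolding P_def[abs_def] by measurable
  qed (simp add: P_def[abs_def])
  have E_eq: "E = {t. \<exists>i. P i t}" by (auto simp: E_def P_def)
  have E_sets [measurable]: "E \<in> sets borel"
    unfolding E_eq by measurable
  have [measurable]: "k \<in> measurable borel (count_space UNIV)" unfolding k_def by measurable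
  have [measurable]: "r \<in> borel_measurable borel" unfolding r_def by measurable
  have k: "k t < n \<and> norm (U (of_real (r t) * cis t)) > \<epsilon>" if "t \<in> E" for t
  proof -
    have "\<exists>i. P i t" using that by (auto simp: E_eq)
    from LeastI_ex[OF this] have "P (k t) t" by (simp only: k_def)
    then show ?thesis using that by (simp add: r_def P_def)
  qed
  \<comment> \<open>Finitely many radii stay below one \<open>p < 1\<close>. All kernels are then
    bounded by the same constant \<open>b\<close>, so the integrability and Fubini conditions below
    reduce to boundedness.\<close>
  define p where "p = Max (insert 0 (q ` {..<n}))"
  have p: "0 \<le> p" "p < 1" "\<And>i. i < n \<Longrightarrow> q i \<le> p"
    unfolding p_def using q by (auto intro: Max_ge)
  have r: "0 \<le> r t" "r t \<le> p" for t
    using k[of t] q[of "k t"] p by (auto simp: r_def)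
  have r1: "r t < 1" for t using r[of t] p by simp
  define K where "K t s = poisson (of_real (r t) * cis t) s" for t s
  have K0: "0 \<le> K t s" for t s
    unfolding K_def using r[of t] r1[of t] by (intro less_imp_le poisson_pos) (auto simp: norm_mult)
  define b where "b = 2 / (1 - p)"
  have b0: "b \<ge> 0" using p by (simp add: b_def)
  have Kb: "K t s \<le> b" for t s
  proof -
    have "K t s \<le> 2 / (1 - r t)"
      unfolding K_def using poisson_le[of "of_real (r t) * cis t" s] r[of t] r1[of t] by (simp add: norm_mult)
    also have "\<dots> \<le> b" unfolding b_def using r[of t] p by (intro divide_left_mono) auto
    finally show ?thesis .
  qed
  have [measurable]: "(\<lambda>x. K (f x) (g x)) \<in> borel_measurable M"
    if [measurable]: "f \<in> borel_measurable M" "g \<in> borel_measurable M" for f g and M :: "'z measure"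
    unfolding K_def by measurable
  define I where "I = (indicator E :: real \<Rightarrow> real)"
  have I: "0 \<le> I t" "I t \<le> 1" for t by (auto simp: I_def)
  have [measurable]: "I \<in> borel_measurable borel" unfolding I_def by measurable
  define w where "w s = (\<integral>t. I t * K t s \<partial>circ_meas)" for s
  have IKb: "\<bar>I t * K t s\<bar> \<le> b" for t s
    using I[of t] K0[of t s] Kb[of t s] by (simp add: abs_mult mult_le_one mult_left_le_one_le order_trans[OF mult_left_le_one_le])
  have [measurable]: "w \<in> borel_measurable borel" unfolding w_def by measurable
  have w0: "0 \<le> w s" for s
    unfolding w_def using I K0 by (intro integral_nonneg_AE) auto
  have wb: "\<bar>w s\<bar> \<le> b" for s
    unfolding w_def by (rule circ_integral_abs_le) (rule IKb)
  have KKb: "\<bar>K t s * K u s\<bar> \<le> b * b" for t s u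
    unfolding abs_mult using Kb K0 b0 by (intro mult_mono) auto
  have wK: "(\<integral>s. w s * K t s \<partial>circ_meas) \<le> 8 * (w t + (\<integral>u. I u * K t u \<partial>circ_meas))" for t
  proof -
    have "(\<integral>s. w s * K t s \<partial>circ_meas) = (\<integral>s. (\<integral>u. I u * K u s * K t s \<partial>circ_meas) \<partial>circ_meas)"
      by (simp add: w_def)
    also have "\<dots> = (\<integral>u. (\<integral>s. I u * K u s * K t s \<partial>circ_meas) \<partial>circ_meas)"
    proof (rule circ_Fubini[where B = "b * b"])
      show "\<bar>I u * K u s * K t s\<bar> \<le> b * b" for u s
        using IKb[of u s] Kb[of t s] K0[of t s] b0 unfolding abs_mult[of _ "K t s"]
        by (intro mult_mono) auto
    qed measurable
    also have "\<dots> = (\<integral>u. I u * poisson (of_real (r u * r t) * cis u) t \<partial>circ_meas)"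
    proof (rule Bochner_Integration.integral_cong[OF refl])
      fix u
      have "(\<integral>s. I u * K u s * K t s \<partial>circ_meas) = I u * (\<integral>s. K u s * K t s \<partial>circ_meas)"
        by (simp add: mult.assoc)
      also have "(\<integral>s. K u s * K t s \<partial>circ_meas) = poisson (of_real (r u * r t) * cis u) t"
        unfolding K_def using r r1 by (intro poisson_semigroup) auto
      finally show "(\<integral>s. I u * K u s * K t s \<partial>circ_meas) = I u * poisson (of_real (r u * r t) * cis u) t" .
    qed
    also have "\<dots> \<le> (\<integral>u. 8 * (I u * K u t) + 8 * (I u * K t u) \<partial>circ_meas)"
    proof (rule integral_mono)
      \<comment> \<open>Domination applies to the smaller of the two radii; adding both kernels
        covers either case.\<close>
      have bd: "poisson (of_real (r u * r t) * cis u) t \<le> 8 * K u t + 8 * K t u" for u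
      proof (cases "r u \<le> r t")
        case True
        then show ?thesis using poisson_dominate[of "r u" "r t" u t] r r1 K0[of t u] by (simp add: K_def)
      next
        case False
        then have "poisson (of_real (r t * r u) * cis t) u \<le> 8 * K t u"
          using poisson_dominate[of "r t" "r u" t u] r r1 by (simp add: K_def)
        then show ?thesis using K0[of u t] poisson_shift[of "r u * r t" u t] by (simp add: mult.commute)
      qed
      have pos: "0 \<le> poisson (of_real (r u * r t) * cis u) t" for u
        using r[of u] r1[of u] r[of t] r1[of t] mult_strict_mono[of "r u" 1 "r t" 1]
        by (intro less_imp_le poisson_pos) (auto simp: norm_mult)
      show mono: "I u * poisson (of_real (r u * r t) * cis u) t \<le> 8 * (I u * K u t) + 8 * (I u * K t u)" for u
        using mult_left_mono[OF bd[of u] I(1)[of u]] by (simp add: algebra_simps)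
      have bd2: "8 * (I u * K u t) + 8 * (I u * K t u) \<le> 16 * b" for u
        using IKb[of u t] mult_mono[OF I(2)[of u] Kb[of t u]] K0[of t u] by simp
      show "integrable circ_meas (\<lambda>u. 8 * (I u * K u t) + 8 * (I u * K t u))"
        using bd2 I K0 by (intro circ_integrable_bounded[where B="16*b"]) auto
      show "integrable circ_meas (\<lambda>u. I u * poisson (of_real (r u * r t) * cis u) t)"
        using mono bd2 I pos
        by (intro circ_integrable_bounded[where B="16*b"]) (auto intro: order_trans)
    qed
    also have "\<dots> = 8 * w t + 8 * (\<integral>u. I u * K t u \<partial>circ_meas)"
    proof -
      have "integrable circ_meas (\<lambda>u. I u * K u t)"
        using IKb by (intro circ_integrable_bounded[where B=b]) auto
      moreover have "integrable circ_meas (\<lambda>u. I u * K t u)"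
        using I Kb K0 b0 by (intro circ_integrable_bounded[where B=b])
          (auto simp: abs_mult intro: order_trans[OF mult_left_le_one_le])
      ultimately show ?thesis by (simp add: w_def)
    qed
    finally show ?thesis by simp
  qed
  have intIw: "integrable circ_meas (\<lambda>t. I t * w t)"
    using I wb b0 by (intro circ_integrable_bounded[where B=b])
      (auto simp: abs_mult intro: order_trans[OF mult_left_le_one_le])
  have intw2: "integrable circ_meas (\<lambda>t. (w t)\<^sup>2)"
    using wb b0 by (intro circ_integrable_bounded[where B="b\<^sup>2"]) (auto simp: abs_le_square_iff[symmetric] w0)
  have intI: "integrable circ_meas I"
    using I by (intro circ_integrable_bounded[where B=1]) auto
  have mE: "integral\<^sup>L circ_meas I = measure circ_meas E"
    unfolding I_def by simp
  have w2: "(\<integral>s. (w s)\<^sup>2 \<partial>circ_meas) \<le> 16 * (\<integral>t. I t * w t \<partial>circ_meas)"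
  proof -
    \<comment> \<open>Duality between T and its adjoint: integrating \<open>w\<close> against
      \<open>v\<close> equals integrating T v over \<open>E\<close>. It is applied to
      \<open>v = w\<close> and, backwards, to \<open>v = I\<close>.\<close>
    have F: "(\<integral>s. (\<integral>t. I t * K t s * v s \<partial>circ_meas) \<partial>circ_meas) = (\<integral>t. I t * (\<integral>s. v s * K t s \<partial>circ_meas) \<partial>circ_meas)"
      if [measurable]: "v \<in> borel_measurable borel" and vb: "\<And>s. \<bar>v s\<bar> \<le> c" for v c
    proof -
      have "(\<integral>s. (\<integral>t. I t * K t s * v s \<partial>circ_meas) \<partial>circ_meas) = (\<integral>t. (\<integral>s. I t * K t s * v s \<partial>circ_meas) \<partial>circ_meas)"
        using IKb vb b0 unfolding abs_mult[of _ "v s" for s]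
        by (intro circ_Fubini[where B="b * c"]) (measurable, simp add: abs_mult[of _ "v s" for s] mult_mono)
      then show ?thesis by (simp add: mult.assoc mult.commute mult.left_commute)
    qed
    have "(\<integral>s. (w s)\<^sup>2 \<partial>circ_meas) = (\<integral>s. (\<integral>t. I t * K t s * w s \<partial>circ_meas) \<partial>circ_meas)"
      by (simp add: power2_eq_square w_def)
    also have "\<dots> = (\<integral>t. I t * (\<integral>s. w s * K t s \<partial>circ_meas) \<partial>circ_meas)"
      by (rule F[OF _ wb]) measurable
    also have "\<dots> \<le> (\<integral>t. 8 * (I t * w t) + 8 * (I t * (\<integral>u. I u * K t u \<partial>circ_meas)) \<partial>circ_meas)"
    proof (rule integral_mono)
      show "I t * (\<integral>s. w s * K t s \<partial>circ_meas) \<le> 8 * (I t * w t) + 8 * (I t * (\<integral>u. I u * K t u \<partial>circ_meas))" for t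
        using mult_left_mono[OF wK[of t] I(1)[of t]] by (simp add: algebra_simps)
      have "\<bar>\<integral>s. w s * K t s \<partial>circ_meas\<bar> \<le> b * b" for t
        using wb Kb K0 b0 by (intro circ_integral_abs_le) (auto simp: abs_mult intro!: mult_mono)
      then show "integrable circ_meas (\<lambda>t. I t * (\<integral>s. w s * K t s \<partial>circ_meas))"
        using I by (intro circ_integrable_bounded[where B="b*b"]) (auto simp: abs_mult intro: order_trans[OF mult_left_le_one_le])
      have "\<bar>\<integral>u. I u * K t u \<partial>circ_meas\<bar> \<le> b" for t
        using I Kb K0 b0 by (intro circ_integral_abs_le)
          (auto simp: abs_mult intro: order_trans[OF mult_left_le_one_le])
      then have "integrable circ_meas (\<lambda>t. I t * (\<integral>u. I u * K t u \<partial>circ_meas))"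
        using I by (intro circ_integrable_bounded[where B="b"]) (auto simp: abs_mult intro: order_trans[OF mult_left_le_one_le])
      then show "integrable circ_meas (\<lambda>t. 8 * (I t * w t) + 8 * (I t * (\<integral>u. I u * K t u \<partial>circ_meas)))"
        using intIw by simp
    qed
    also have "\<dots> = 8 * (\<integral>t. I t * w t \<partial>circ_meas) + 8 * (\<integral>t. I t * (\<integral>u. I u * K t u \<partial>circ_meas) \<partial>circ_meas)"
    proof -
      have "\<bar>\<integral>u. I u * K t u \<partial>circ_meas\<bar> \<le> b" for t
        using I Kb K0 b0 by (intro circ_integral_abs_le)
          (auto simp: abs_mult intro: order_trans[OF mult_left_le_one_le])
      then have "integrable circ_meas (\<lambda>t. I t * (\<integral>u. I u * K t u \<partial>circ_meas))"
        using I by (intro circ_integrable_bounded[where B="b"]) (auto simp: abs_mult intro: order_trans[OF mult_left_le_one_le])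
      then show ?thesis using intIw by simp
    qed
    also have "(\<integral>t. I t * (\<integral>u. I u * K t u \<partial>circ_meas) \<partial>circ_meas) = (\<integral>s. (\<integral>t. I t * K t s * I s \<partial>circ_meas) \<partial>circ_meas)"
      using I by (intro F[symmetric, where c=1]) auto
    also have "\<dots> = (\<integral>t. I t * w t \<partial>circ_meas)"
      by (simp add: w_def mult.commute)
    finally show ?thesis by simp
  qed
  have w2': "(\<integral>s. (w s)\<^sup>2 \<partial>circ_meas) \<le> 256 * measure circ_meas E"
  proof -
    \<comment> \<open>Since \<open>(w t - 16)^2 \<ge> 0\<close>, half of the integral of
      \<open>w^2\<close> can be absorbed on the left, which leaves 2 * 128 = 256.\<close>
    have "16 * (\<integral>t. I t * w t \<partial>circ_meas) = (\<integral>t. 16 * (I t * w t) \<partial>circ_meas)" by simp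
    also have "\<dots> \<le> (\<integral>t. (w t)\<^sup>2 / 2 + 128 * I t \<partial>circ_meas)"
    proof (rule integral_mono)
      show "16 * (I t * w t) \<le> (w t)\<^sup>2 / 2 + 128 * I t" for t
      proof (cases "t \<in> E")
        case True
        have "0 \<le> (w t - 16)\<^sup>2" by simp
        then show ?thesis using True by (simp add: I_def power2_eq_square algebra_simps)
      qed (simp add: I_def)
    qed (use intIw intw2 intI in auto)
    also have "\<dots> = (\<integral>t. (w t)\<^sup>2 \<partial>circ_meas) / 2 + 128 * measure circ_meas E"
      using intw2 intI mE by simp
    finally show ?thesis using w2 by simp
  qed
  obtain M where M: "\<And>t. norm (U (cis t)) \<le> M"
  proof -
    have "compact (U ` sphere 0 1)"
      using \<rho> by (intro compact_continuous_image continuous_on_subset[OF contU]) auto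
    then obtain M where "\<forall>x\<in>U ` sphere 0 1. norm x \<le> M"
      using compact_imp_bounded bounded_iff by blast
    then show ?thesis by (intro that[of M]) auto
  qed
  have M0: "0 \<le> M" using M[of 0] norm_ge_zero order_trans by blast
  have intU2: "integrable circ_meas (\<lambda>t. (norm (U (cis t)))\<^sup>2)"
    using M by (intro circ_integrable_bounded[where B="M\<^sup>2"]) (auto intro: power_mono)
  have Uw: "\<epsilon> * measure circ_meas E \<le> (\<integral>s. norm (U (cis s)) * w s \<partial>circ_meas)"
  proof -
    have UK: "norm (U (of_real (r t) * cis t)) \<le> (\<integral>s. K t s * norm (U (cis s)) \<partial>circ_meas)" for t
    proof -
      have "norm (of_real (r t) * cis t) < 1" using r[of t] r1[of t] by (simp add: norm_mult)
      from circ_poisson[OF U \<rho> this]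
      have "U (of_real (r t) * cis t) = (\<integral>s. K t s * U (cis s) \<partial>circ_meas)" by (simp add: K_def)
      also have "norm \<dots> \<le> (\<integral>s. norm (K t s * U (cis s)) \<partial>circ_meas)" by (rule integral_norm_bound)
      also have "\<dots> = (\<integral>s. K t s * norm (U (cis s)) \<partial>circ_meas)" using K0 by (simp add: norm_mult)
      finally show ?thesis .
    qed
    have "\<epsilon> * measure circ_meas E = (\<integral>t. \<epsilon> * I t \<partial>circ_meas)" using mE by simp
    also have "\<dots> \<le> (\<integral>t. (\<integral>s. I t * K t s * norm (U (cis s)) \<partial>circ_meas) \<partial>circ_meas)"
    proof (rule integral_mono)
      show "\<epsilon> * I t \<le> (\<integral>s. I t * K t s * norm (U (cis s)) \<partial>circ_meas)" for t
        using k[of t] UK[of t] by (cases "t \<in> E") (auto simp: I_def)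
      have "\<bar>\<integral>s. I t * K t s * norm (U (cis s)) \<partial>circ_meas\<bar> \<le> b * M" for t
        using IKb M b0 by (intro circ_integral_abs_le) (auto simp: abs_mult[of _ "norm _"] intro!: mult_mono)
      then show "integrable circ_meas (\<lambda>t. \<integral>s. I t * K t s * norm (U (cis s)) \<partial>circ_meas)"
        by (intro circ_integrable_bounded[where B="b*M"]) auto
    qed (use intI in auto)
    also have "\<dots> = (\<integral>s. (\<integral>t. I t * K t s * norm (U (cis s)) \<partial>circ_meas) \<partial>circ_meas)"
    proof (rule circ_Fubini[symmetric, where B="b*M"])
      show "\<bar>I t * K t s * norm (U (cis s))\<bar> \<le> b * M" for t s
        using IKb M b0 by (auto simp: abs_mult[of _ "norm _"] intro!: mult_mono)
    qed measurable
    also have "\<dots> = (\<integral>s. norm (U (cis s)) * w s \<partial>circ_meas)"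
      by (simp add: w_def mult.commute)
    finally show ?thesis .
  qed
  \<comment> \<open>Weighted Young inequality. The weight \<open>\<epsilon> / 512\<close> makes the
    bound 256 m(E) contribute exactly half of the left-hand side \<open>\<epsilon> * m(E)\<close>;
    the weight \<open>128 / \<epsilon>\<close> is then forced by completing the square.\<close>
  also have "\<dots> \<le> (\<integral>s. 128 / \<epsilon> * (norm (U (cis s)))\<^sup>2 + \<epsilon> / 512 * (w s)\<^sup>2 \<partial>circ_meas)"
  proof (rule integral_mono)
    show "integrable circ_meas (\<lambda>s. norm (U (cis s)) * w s)"
      using M wb M0 by (intro circ_integrable_bounded[where B="M * b"]) (auto simp: abs_mult intro!: mult_mono)
    show "integrable circ_meas (\<lambda>s. 128 / \<epsilon> * (norm (U (cis s)))\<^sup>2 + \<epsilon> / 512 * (w s)\<^sup>2)"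
      using intU2 intw2 by simp
    show "norm (U (cis s)) * w s \<le> 128 / \<epsilon> * (norm (U (cis s)))\<^sup>2 + \<epsilon> / 512 * (w s)\<^sup>2" for s
    proof -
      have "0 \<le> (norm (U (cis s)) * 256 - \<epsilon> * w s)\<^sup>2 / (512 * \<epsilon>)" using \<epsilon> by simp
      also have "\<dots> = 128 / \<epsilon> * (norm (U (cis s)))\<^sup>2 + \<epsilon> / 512 * (w s)\<^sup>2 - norm (U (cis s)) * w s"
        using \<epsilon> by (simp add: field_simps power2_eq_square)
      finally show ?thesis by simp
    qed
  qed
  also have "\<dots> = 128 / \<epsilon> * (\<integral>s. (norm (U (cis s)))\<^sup>2 \<partial>circ_meas) + \<epsilon> / 512 * (\<integral>s. (w s)\<^sup>2 \<partial>circ_meas)"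
    using intU2 intw2 by simp
  also have "\<dots> \<le> 128 / \<epsilon> * (\<integral>s. (norm (U (cis s)))\<^sup>2 \<partial>circ_meas) + \<epsilon> / 512 * (256 * measure circ_meas E)"
    using w2' \<epsilon> by (intro add_left_mono mult_left_mono) auto
  finally have "\<epsilon> / 2 * measure circ_meas E \<le> 128 / \<epsilon> * (\<integral>s. (norm (U (cis s)))\<^sup>2 \<partial>circ_meas)"
    by simp
  then show ?thesis
    unfolding E_def[symmetric] using \<epsilon> by (simp add: field_simps power2_eq_square)
qed

text \<open>The squared second integral mean; a bound uniform in \<open>R < 1\<close> expresses
  membership in H^2.\<close>

definition circ_square :: "(complex \<Rightarrow> complex) \<Rightarrow> real \<Rightarrow> real" where
  "circ_square f R = (\<integral>t. (norm (f (of_real R * cis t)))\<^sup>2 \<partial>circ_meas)"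

lemma continuous_on_circle:
  assumes "f holomorphic_on ball 0 1" "0 \<le> R" "R < 1"
  shows "continuous_on UNIV (\<lambda>t. f (of_real R * cis t))"
  using assms
  by (intro continuous_on_compose2[OF holomorphic_on_imp_continuous_on[OF assms(1)]] continuous_intros)
    (auto simp: norm_mult)

text \<open>A nonempty open superlevel set contains a rational. This turns conditions over all radii
  into countable ones, hence into Borel conditions on the angle.\<close>

lemma exists_Rats_gt:
  fixes h :: "real \<Rightarrow> real"
  assumes h: "continuous_on {a<..<b} h" and r: "r \<in> {a<..<b}" "h r > c"
  shows "\<exists>x\<in>\<rat> \<inter> {a<..<b}. h x > c"
proof -
  have "open (h -` {c<..} \<inter> {a<..<b})"
    using h by (simp add: continuous_on_open_vimage)
  moreover have "r \<in> h -` {c<..} \<inter> {a<..<b}" using r by auto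
  ultimately obtain d where d: "d > 0" "ball r d \<subseteq> h -` {c<..} \<inter> {a<..<b}"
    by (meson openE)
  obtain x where x: "x \<in> \<rat>" "r < x" "x < r + d"
    using Rats_dense_in_real[of r "r + d"] d(1) by auto
  then have "x \<in> ball r d" by (auto simp: dist_real_def)
  with d(2) x(1) show ?thesis by (intro bexI[of _ x]) auto
qed

text \<open>By continuity in the radius, rational radii suffice. The finite inequality has a
  constant independent of the number of radii, so continuity of the measure along the increasing
  sets \<open>En n\<close> yields the full supremum.\<close>

lemma maximal_inequality:
  assumes f: "f holomorphic_on ball 0 1"
    and B: "\<And>R. 0 < R \<Longrightarrow> R < 1 \<Longrightarrow> circ_square f R \<le> B" and \<epsilon>: "\<epsilon> > 0"
  shows "{t. \<exists>r\<in>{0<..<1}. norm (f (of_real r * cis t)) > \<epsilon>} \<in> sets borel" (is "?E \<in> _")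
    and "measure circ_meas {t. \<exists>r\<in>{0<..<1}. norm (f (of_real r * cis t)) > \<epsilon>} \<le> 256 * B / \<epsilon>\<^sup>2"
proof -
  have "countable ({0<..<1::real} \<inter> \<rat>)" by (intro countable_Int2 countable_rat)
  moreover have "{0<..<1::real} \<inter> \<rat> \<noteq> {}"
    using Rats_dense_in_real[of 0 1] by auto
  ultimately obtain q :: "nat \<Rightarrow> real" where q: "range q = {0<..<1} \<inter> \<rat>"
    by (intro that[OF range_from_nat_into])
  have q01: "0 < q i" "q i < 1" for i
  proof -
    have "q i \<in> {0<..<1} \<inter> \<rat>" using q rangeI[of q i] by simp
    then show "0 < q i" "q i < 1" by auto
  qed
  define En where "En n = {t. \<exists>i<n. norm (f (of_real (q i) * cis t)) > \<epsilon>}" for n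
  have contf: "continuous_on (ball 0 1) f" using f by (rule holomorphic_on_imp_continuous_on)
  have [measurable]: "(\<lambda>t. f (of_real (q i) * cis t)) \<in> borel_measurable borel" for i
    using q01[of i] by (intro borel_measurable_continuous_onI continuous_on_circle f) auto
  have Em [measurable]: "En n \<in> sets borel" for n unfolding En_def by measurable
  have EU: "?E = (\<Union>n. En n)"
  proof (intro equalityI subsetI)
    fix t assume "t \<in> ?E"
    then obtain r where r: "0 < r" "r < 1" "norm (f (of_real r * cis t)) > \<epsilon>" by auto
    have "continuous_on {0<..<1} (\<lambda>r::real. norm (f (of_real r * cis t)))"
      by (intro continuous_intros continuous_on_compose2[OF contf]) (auto simp: norm_mult)
    from exists_Rats_gt[OF this, of r \<epsilon>] r
    obtain x where x: "x \<in> \<rat>" and x2: "x \<in> {0<..<1} \<and> norm (f (of_real x * cis t)) > \<epsilon>"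
      by auto
    then have "x \<in> range q" using q x by auto
    then obtain i where "x = q i" by auto
    with x2 have "t \<in> En (Suc i)" by (auto simp: En_def)
    then show "t \<in> (\<Union>n. En n)" by blast
  qed (use q01 in \<open>auto simp: En_def\<close>)
  show "?E \<in> sets borel" unfolding EU by measurable
  have "measure circ_meas (En n) \<le> 256 * B / \<epsilon>\<^sup>2" for n
  proof -
    define p where "p = Max (insert 0 (q ` {..<n}))"
    have p: "0 \<le> p" "p < 1" "\<And>i. i < n \<Longrightarrow> q i \<le> p"
      unfolding p_def using q01 by (auto intro: Max_ge)
    \<comment> \<open>A radius strictly between the largest tested one and 1: the dilate by
      \<open>R\<close> is analytic past the circle, and the rescaled radii \<open>q i / R\<close>
      remain below 1.\<close>
    define R where "R = (1 + p) / 2"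
    have R: "0 < R" "R < 1" "p < R" using p by (auto simp: R_def)
    define U where "U = (\<lambda>z. f (of_real R * z))"
    have "U holomorphic_on ball 0 (1/R)"
      unfolding U_def using R
      by (intro holomorphic_on_compose_gen[OF _ f, unfolded o_def] holomorphic_intros)
        (auto simp: norm_mult field_simps)
    moreover have "0 \<le> q i / R \<and> q i / R < 1" if "i < n" for i
      using p(3)[OF that] q01[of i] R by auto
    ultimately have "measure circ_meas {t. \<exists>i<n. norm (U (of_real (q i / R) * cis t)) > \<epsilon>}
           \<le> 256 * (\<integral>t. (norm (U (cis t)))\<^sup>2 \<partial>circ_meas) / \<epsilon>\<^sup>2"
      using R \<epsilon> by (intro maximal_inequality_finite[where \<rho>="1/R"]) auto
    also have "{t. \<exists>i<n. norm (U (of_real (q i / R) * cis t)) > \<epsilon>} = En n"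
      unfolding En_def U_def using R by (simp add: mult.assoc[symmetric])
    also have "(\<integral>t. (norm (U (cis t)))\<^sup>2 \<partial>circ_meas) = circ_square f R"
      by (simp add: U_def circ_square_def)
    also have "256 * circ_square f R / \<epsilon>\<^sup>2 \<le> 256 * B / \<epsilon>\<^sup>2"
      using B[of R] R by (intro divide_right_mono) auto
    finally show ?thesis .
  qed
  moreover have "(\<lambda>n. measure circ_meas (En n)) \<longlonglongrightarrow> measure circ_meas (\<Union>n. En n)"
    by (rule circ.finite_Lim_measure_incseq) (auto simp: incseq_def En_def intro: less_le_trans)
  ultimately show "measure circ_meas ?E \<le> 256 * B / \<epsilon>\<^sup>2"
    unfolding EU by (intro LIMSEQ_le_const2) auto
qed

section \<open>Radial limits in the Hardy space\<close>

lemma circ_sums_integral: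
  fixes a :: "nat \<Rightarrow> complex" and c :: "real \<Rightarrow> complex"
  assumes a: "summable (\<lambda>n. norm (a n))" and [measurable]: "c \<in> borel_measurable borel"
    and c: "\<And>t. norm (c t) \<le> C"
  shows "(\<lambda>n. a n * (\<integral>t. cis (real n * t) * c t \<partial>circ_meas)) sums
           (\<integral>t. (\<Sum>n. a n * cis (real n * t)) * c t \<partial>circ_meas)"
proof -
  have sm: "summable (\<lambda>n. norm (a n * cis (real n * t) * c t))" for t
    using summable_mult2[OF a, of "norm (c t)"] by (simp add: norm_mult)
  have int: "integrable circ_meas (\<lambda>t. a n * cis (real n * t) * c t)" for n
  proof (rule circ_integrable_bounded[where B="norm (a n) * C"])
    show "norm (a n * cis (real n * t) * c t) \<le> norm (a n) * C" for t
      using c[of t] by (simp add: norm_mult mult_left_mono)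
  qed measurable
  have le: "(\<integral>t. norm (a n * cis (real n * t) * c t) \<partial>circ_meas) \<le> norm (a n) * C" for n
  proof -
    have "\<bar>\<integral>t. norm (a n * cis (real n * t) * c t) \<partial>circ_meas\<bar> \<le> norm (a n) * C"
      using c by (intro circ_integral_abs_le) (simp add: norm_mult mult_left_mono)
    then show ?thesis by simp
  qed
  have "(\<lambda>n. (\<integral>t. a n * cis (real n * t) * c t \<partial>circ_meas)) sums
           (\<integral>t. (\<Sum>n. a n * cis (real n * t) * c t) \<partial>circ_meas)"
  proof (rule sums_integral[OF int])
    show "summable (\<lambda>n. \<integral>t. norm (a n * cis (real n * t) * c t) \<partial>circ_meas)"
      by (rule summable_comparison_test'[OF summable_mult2[OF a, of C], of 0]) (use le in auto)
  qed (use sm in auto)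
  moreover have "(\<Sum>n. a n * cis (real n * t) * c t) = (\<Sum>n. a n * cis (real n * t)) * c t" for t
  proof -
    have "summable (\<lambda>n. a n * cis (real n * t))"
      by (rule summable_norm_cancel) (use a in \<open>simp add: norm_mult\<close>)
    then show ?thesis by (rule suminf_mult2[symmetric])
  qed
  moreover have "(\<integral>t. a n * cis (real n * t) * c t \<partial>circ_meas) = a n * (\<integral>t. cis (real n * t) * c t \<partial>circ_meas)" for n
    by (simp add: mult.assoc)
  ultimately show ?thesis by (simp only:)
qed

lemma circ_parseval:
  fixes a :: "nat \<Rightarrow> complex"
  assumes a: "summable (\<lambda>n. norm (a n))"
  shows "(\<lambda>n. (norm (a n))\<^sup>2) sums (\<integral>t. (norm (\<Sum>n. a n * cis (real n * t)))\<^sup>2 \<partial>circ_meas)"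
proof -
  define F where "F t = (\<Sum>n. a n * cis (real n * t))" for t
  have [measurable]: "F \<in> borel_measurable borel" unfolding F_def by measurable
  have [measurable]: "cnj \<in> borel_measurable borel"
    by (intro borel_measurable_continuous_onI continuous_intros)
  have [measurable]: "(\<lambda>t. cnj (F t)) \<in> borel_measurable borel" by measurable
  have Fb: "norm (F t) \<le> (\<Sum>n. norm (a n))" for t
    unfolding F_def using summable_norm[of "\<lambda>n. a n * cis (real n * t)"] a by (simp add: norm_mult)
  have coeff: "(\<integral>t. F t * cis (- (real m * t)) \<partial>circ_meas) = a m" for m
  proof -
    have "(\<lambda>n. a n * (\<integral>t. cis (real n * t) * cis (- (real m * t)) \<partial>circ_meas)) sums
           (\<integral>t. F t * cis (- (real m * t)) \<partial>circ_meas)"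
      unfolding F_def by (rule circ_sums_integral[OF a, where C=1]) auto
    moreover have "(\<lambda>n. a n * (\<integral>t. cis (real n * t) * cis (- (real m * t)) \<partial>circ_meas)) sums a m"
      using sums_single[of m a] unfolding circ_ortho by (simp add: if_distrib cong: if_cong)
    ultimately show ?thesis by (rule sums_unique2)
  qed
  \<comment> \<open>Termwise integration a second time, now against the conjugate of the sum itself;
    the first use, against single exponentials, has already identified the coefficients.\<close>
  have "(\<lambda>n. a n * (\<integral>t. cis (real n * t) * cnj (F t) \<partial>circ_meas)) sums (\<integral>t. F t * cnj (F t) \<partial>circ_meas)"
    using circ_sums_integral[OF a, of "\<lambda>t. cnj (F t)" "\<Sum>n. norm (a n)"] Fb
    by (simp add: F_def[symmetric])
  moreover have "(\<integral>t. cis (real n * t) * cnj (F t) \<partial>circ_meas) = cnj (a n)" for n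
  proof -
    have "(\<integral>t. cis (real n * t) * cnj (F t) \<partial>circ_meas) = (\<integral>t. cnj (F t * cis (- (real n * t))) \<partial>circ_meas)"
      by (simp add: cis_cnj mult.commute)
    also have "\<dots> = cnj (a n)" unfolding Bochner_Integration.integral_cnj coeff ..
    finally show ?thesis .
  qed
  ultimately have "(\<lambda>n. complex_of_real ((norm (a n))\<^sup>2)) sums (\<integral>t. complex_of_real ((norm (F t))\<^sup>2) \<partial>circ_meas)"
    by (simp only: complex_norm_square)
  then have "(\<lambda>n. complex_of_real ((norm (a n))\<^sup>2)) sums of_real (\<integral>t. (norm (F t))\<^sup>2 \<partial>circ_meas)"
    by (simp only: integral_complex_of_real)
  then show ?thesis unfolding F_def[symmetric] by (simp only: sums_of_real_iff)
qed

lemma circ_square_sums: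
  assumes a: "\<And>z. norm z < 1 \<Longrightarrow> (\<lambda>n. a n * z ^ n) sums f z" and R: "0 \<le> R" "R < 1"
  shows "(\<lambda>n. (norm (a n))\<^sup>2 * R ^ (2 * n)) sums circ_square f R"
proof -
  \<comment> \<open>Convergence at a larger radius gives absolute convergence at
    \<open>R\<close>.\<close>
  define R' where "R' = (1 + R) / 2"
  have R': "R < R'" "0 < R'" "R' < 1" using R by (auto simp: R'_def)
  have "summable (\<lambda>n. norm (a n * of_real R ^ n))"
    by (rule powser_insidea[OF sums_summable[OF a[of "of_real R'"]]]) (use R R' in auto)
  from circ_parseval[OF this]
  have "(\<lambda>n. (norm (a n * of_real R ^ n))\<^sup>2) sums
      (\<integral>t. (norm (\<Sum>n. a n * of_real R ^ n * cis (real n * t)))\<^sup>2 \<partial>circ_meas)" .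
  moreover have "(\<Sum>n. a n * of_real R ^ n * cis (real n * t)) = f (of_real R * cis t)" for t
    using sums_unique[OF a[of "of_real R * cis t"]] R
    by (simp add: norm_mult power_mult_distrib Complex.DeMoivre mult.assoc)
  moreover have "(norm (a n * of_real R ^ n))\<^sup>2 = (norm (a n))\<^sup>2 * R ^ (2 * n)" for n
    using R by (simp add: norm_mult norm_power power_mult_distrib power_mult[symmetric] mult.commute)
  ultimately show ?thesis by (simp add: circ_square_def)
qed

text \<open>Each finite section of Parseval's identity is a polynomial in \<open>R\<close>, so the
  uniform bound survives the limit \<open>R\<close> to 1 in every partial sum.\<close>

lemma summable_square_coeffs:
  assumes a: "\<And>z. norm z < 1 \<Longrightarrow> (\<lambda>n. a n * z ^ n) sums f z"
    and B: "\<And>R. 0 < R \<Longrightarrow> R < 1 \<Longrightarrow> circ_square f R \<le> B"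
  shows "summable (\<lambda>n. (norm (a n))\<^sup>2)"
proof (rule summableI_nonneg_bounded)
  fix m
  have "((\<lambda>R. \<Sum>n<m. (norm (a n))\<^sup>2 * R ^ (2 * n)) \<longlongrightarrow> (\<Sum>n<m. (norm (a n))\<^sup>2 * 1 ^ (2 * n))) (at_left 1)"
    by (intro tendsto_intros)
  moreover have "\<forall>\<^sub>F R in at_left 1. (\<Sum>n<m. (norm (a n))\<^sup>2 * R ^ (2 * n)) \<le> B"
    using eventually_at_left_real[OF zero_less_one]
  proof eventually_elim
    case (elim R)
    then have s: "(\<lambda>n. (norm (a n))\<^sup>2 * R ^ (2 * n)) sums circ_square f R"
      by (intro circ_square_sums a) auto
    have "(\<Sum>n<m. (norm (a n))\<^sup>2 * R ^ (2 * n)) \<le> circ_square f R"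
      by (rule sum_le_suminf[OF sums_summable[OF s], of "{..<m}", unfolded sums_unique[OF s, symmetric]]) auto
    also have "\<dots> \<le> B" using elim by (intro B) auto
    finally show ?case .
  qed
  ultimately show "(\<Sum>n<m. (norm (a n))\<^sup>2) \<le> B"
    by (intro tendsto_upperbound[where F="at_left (1::real)"]) auto
qed auto

section \<open>Existence, measurability and almost everywhere convergence of radial limits\<close>

lemma radial_Cauchy_limit:
  fixes g :: "real \<Rightarrow> complex"
  assumes "\<And>\<epsilon>. \<epsilon> > 0 \<Longrightarrow> \<exists>\<delta><1. \<forall>r\<in>{\<delta><..<1}. \<forall>s\<in>{\<delta><..<1}. dist (g r) (g s) \<le> \<epsilon>"
  shows "\<exists>L. (g \<longlongrightarrow> L) (at_left 1)"
proof -
  define x where "x n = 1 - inverse (real (Suc n))" for n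
  have x: "x \<longlonglongrightarrow> 1"
    unfolding x_def using tendsto_diff[OF tendsto_const LIMSEQ_inverse_real_of_nat, of 1] by simp
  have x1: "x n < 1" for n by (simp add: x_def)
  have "Cauchy (\<lambda>n. g (x n))"
  proof (rule metric_CauchyI)
    fix e :: real assume "e > 0"
    then obtain \<delta> where \<delta>: "\<delta> < 1" "\<forall>r\<in>{\<delta><..<1}. \<forall>s\<in>{\<delta><..<1}. dist (g r) (g s) \<le> e / 2"
      using assms[of "e/2"] by auto
    obtain N where "\<And>n. n \<ge> N \<Longrightarrow> x n > \<delta>"
      using order_tendstoD(1)[OF x \<delta>(1)] by (auto simp: eventually_sequentially)
    then have "dist (g (x m)) (g (x n)) \<le> e / 2" if "m \<ge> N" "n \<ge> N" for m n
      using \<delta>(2) x1 that by auto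
    then show "\<exists>M. \<forall>m\<ge>M. \<forall>n\<ge>M. dist (g (x m)) (g (x n)) < e"
      using \<open>e > 0\<close> by (intro exI[of _ N]) (auto intro: le_less_trans[of _ "e/2"])
  qed
  then obtain L where L: "(\<lambda>n. g (x n)) \<longlonglongrightarrow> L"
    using convergent_eq_Cauchy by blast
  have "(g \<longlongrightarrow> L) (at_left 1)"
  proof (rule tendstoI)
    fix e :: real assume "e > 0"
    then obtain \<delta> where \<delta>: "\<delta> < 1" "\<forall>r\<in>{\<delta><..<1}. \<forall>s\<in>{\<delta><..<1}. dist (g r) (g s) \<le> e / 2"
      using assms[of "e/2"] by auto
    have "dist (g r) L \<le> e / 2" if r: "\<delta> < r" "r < 1" for r
    proof (rule tendsto_upperbound)
      show "(\<lambda>n. dist (g r) (g (x n))) \<longlonglongrightarrow> dist (g r) L" by (intro tendsto_intros L)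
      show "\<forall>\<^sub>F n in sequentially. dist (g r) (g (x n)) \<le> e / 2"
        using order_tendstoD(1)[OF x \<delta>(1)] by eventually_elim (use \<delta>(2) r x1 in auto)
    qed auto
    then show "\<forall>\<^sub>F r in at_left 1. dist (g r) L < e"
      using eventually_at_left_real[OF \<delta>(1)] \<open>e > 0\<close> by (auto elim!: eventually_mono intro: le_less_trans[of _ "e/2"])
  qed
  then show ?thesis ..
qed

text \<open>A Cauchy criterion with only countable quantifiers, so that the set of angles with a
  radial limit is Borel. Continuity frees one radius at a time from being rational: first r with s
  rational, then s.\<close>

lemma radial_limit_iff_Rats:
  fixes g :: "real \<Rightarrow> complex"
  assumes g: "continuous_on {0<..<1} g"
  shows "(\<exists>L. (g \<longlongrightarrow> L) (at_left 1)) \<longleftrightarrow>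
    (\<forall>j. \<exists>k. \<forall>r\<in>\<rat> \<inter> {1 - inverse (real (Suc k))<..<1}. \<forall>s\<in>\<rat> \<inter> {1 - inverse (real (Suc k))<..<1}.
       dist (g r) (g s) \<le> inverse (real (Suc j)))" (is "?L \<longleftrightarrow> ?R")
proof
  assume ?L
  then obtain L where L: "(g \<longlongrightarrow> L) (at_left 1)" ..
  show ?R
  proof
    fix j
    define e where "e = inverse (real (Suc j))"
    have "e > 0" by (simp add: e_def)
    then have "\<forall>\<^sub>F r in at_left 1. dist (g r) L < e / 2" using L by (intro tendstoD) auto
    then obtain b where b: "b < 1" "\<And>r. b < r \<Longrightarrow> r < 1 \<Longrightarrow> dist (g r) L < e / 2"
      unfolding eventually_at_left_field by auto
    obtain k where "inverse (real (Suc k)) < 1 - b" using reals_Archimedean[of "1 - b"] b by auto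
    then have "dist (g r) L < e / 2" if "r \<in> {1 - inverse (real (Suc k))<..<1}" for r
      using that by (intro b) auto
    then have "dist (g r) (g s) \<le> e"
      if "r \<in> {1 - inverse (real (Suc k))<..<1}" "s \<in> {1 - inverse (real (Suc k))<..<1}" for r s
      using that dist_triangle_half_r[of L "g r" e "g s"] by (auto simp: dist_commute less_imp_le)
    then show "\<exists>k. \<forall>r\<in>\<rat> \<inter> {1 - inverse (real (Suc k))<..<1}. \<forall>s\<in>\<rat> \<inter> {1 - inverse (real (Suc k))<..<1}.
       dist (g r) (g s) \<le> inverse (real (Suc j))"
      unfolding e_def by blast
  qed
next
  assume R: ?R
  show ?L
  proof (rule radial_Cauchy_limit)
    fix \<epsilon> :: real assume "\<epsilon> > 0"
    then obtain j where j: "inverse (real (Suc j)) < \<epsilon>" using reals_Archimedean by auto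
    from R obtain k where k: "\<And>r s. r \<in> \<rat> \<inter> {1 - inverse (real (Suc k))<..<1} \<Longrightarrow>
        s \<in> \<rat> \<inter> {1 - inverse (real (Suc k))<..<1} \<Longrightarrow> dist (g r) (g s) \<le> inverse (real (Suc j))"
      by meson
    define \<delta> where "\<delta> = 1 - inverse (real (Suc k))"
    \<comment> \<open>This keeps the interval inside (0, 1), where \<open>g\<close> is
      continuous.\<close>
    have "inverse (real (Suc k)) \<le> 1" by (simp add: inverse_le_1_iff)
    then have \<delta>: "0 \<le> \<delta>" "\<delta> < 1" by (simp_all add: \<delta>_def)
    have cg: "continuous_on {\<delta><..<1} g" using \<delta> by (intro continuous_on_subset[OF g]) auto
    have 1: "dist (g r) (g s) \<le> inverse (real (Suc j))"
      if r: "r \<in> {\<delta><..<1}" and s: "s \<in> \<rat> \<inter> {\<delta><..<1}" for r s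
    proof (rule ccontr)
      assume "\<not> ?thesis"
      moreover have "continuous_on {\<delta><..<1} (\<lambda>r. dist (g r) (g s))" by (intro continuous_intros cg)
      ultimately obtain x where "x \<in> \<rat> \<inter> {\<delta><..<1}" "dist (g x) (g s) > inverse (real (Suc j))"
        using exists_Rats_gt[of \<delta> 1 "\<lambda>r. dist (g r) (g s)" r "inverse (real (Suc j))"] r by (auto simp: not_le)
      then show False using k[of x s] s by (auto simp: \<delta>_def)
    qed
    have "dist (g r) (g s) \<le> inverse (real (Suc j))"
      if r: "r \<in> {\<delta><..<1}" and s: "s \<in> {\<delta><..<1}" for r s
    proof (rule ccontr)
      assume "\<not> ?thesis"
      moreover have "continuous_on {\<delta><..<1} (\<lambda>s. dist (g r) (g s))" by (intro continuous_intros cg)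
      ultimately obtain x where "x \<in> \<rat> \<inter> {\<delta><..<1}" "dist (g r) (g x) > inverse (real (Suc j))"
        using exists_Rats_gt[of \<delta> 1 "\<lambda>s. dist (g r) (g s)" s "inverse (real (Suc j))"] s by (auto simp: not_le)
      then show False using 1[of r x] r by auto
    qed
    then show "\<exists>\<delta><1. \<forall>r\<in>{\<delta><..<1}. \<forall>s\<in>{\<delta><..<1}. dist (g r) (g s) \<le> \<epsilon>"
      using \<delta> j by (intro exI[of _ \<delta>]) (auto intro: order_trans[OF _ less_imp_le[OF j]])
  qed
qed

text \<open>Where the radial limit does not exist, \<^const>\<open>boundary_fun\<close> takes the constant value \<open>THE L. False\<close>.\<close>
lemma boundary_fun_measurable:
  assumes f: "f holomorphic_on ball 0 1"
  shows "boundary_fun f \<in> borel_measurable borel"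
proof -
  \<comment> \<open>The double \<open>Suc\<close> starts the sequence at 1/2, so every radius is
    strictly positive.\<close>
  define x where "x n = 1 - inverse (real (Suc (Suc n)))" for n
  have x: "x \<longlonglongrightarrow> 1"
    unfolding x_def using tendsto_diff[OF tendsto_const LIMSEQ_Suc[OF LIMSEQ_inverse_real_of_nat], of 1] by simp
  have x1: "0 < x n" "x n < 1" for n by (simp_all add: x_def inverse_less_1_iff)
  have xlim: "filterlim x (at_left 1) sequentially"
    using x x1 by (auto simp: filterlim_at less_imp_neq)
  have fm [measurable]: "(\<lambda>t. f (of_real r * cis t)) \<in> borel_measurable borel" if "0 < r" "r < 1" for r
    using that by (intro borel_measurable_continuous_onI continuous_on_circle f) auto
  define T where "T = {t. \<exists>L. ((\<lambda>r. f (of_real r * cis t)) \<longlongrightarrow> L) (at_left 1)}"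
  have cont: "continuous_on {0<..<1} (\<lambda>r::real. f (of_real r * cis t))" for t
    by (intro continuous_on_compose2[OF holomorphic_on_imp_continuous_on[OF f]] continuous_intros)
      (auto simp: norm_mult)
  define D where "D k = \<rat> \<inter> {1 - inverse (real (Suc k))<..<1}" for k
  have Dc: "countable (D k)" for k
    unfolding D_def by (intro countable_Int1 countable_rat)
  have D01: "0 < r" "r < 1" if "r \<in> D k" for r k
  proof -
    have "inverse (real (Suc k)) \<le> 1" by (simp add: inverse_le_1_iff)
    then show "0 < r" "r < 1" using that unfolding D_def by auto
  qed
  have "T = {t. \<forall>j. \<exists>k. \<forall>r\<in>D k. \<forall>s\<in>D k. dist (f (of_real r * cis t)) (f (of_real s * cis t)) \<le> inverse (real (Suc j))}"
    unfolding T_def D_def radial_limit_iff_Rats[OF cont] ..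
  also have "\<dots> \<in> sets borel"
  proof -
    have "Measurable.pred borel (\<lambda>t. dist (f (of_real r * cis t)) (f (of_real s * cis t)) \<le> inverse (real (Suc j)))"
      if "r \<in> D k" "s \<in> D k" for j k r s
    proof -
      have [measurable]: "(\<lambda>t. f (of_real r * cis t)) \<in> borel_measurable borel"
        "(\<lambda>t. f (of_real s * cis t)) \<in> borel_measurable borel"
        using D01 that by (auto intro!: fm)
      show ?thesis by measurable
    qed
    then have "Measurable.pred borel (\<lambda>t. \<forall>j. \<exists>k. \<forall>r\<in>D k. \<forall>s\<in>D k.
        dist (f (of_real r * cis t)) (f (of_real s * cis t)) \<le> inverse (real (Suc j)))"
      by (intro pred_intros_countable measurable_pred_countable Dc)
    then show ?thesis by (simp add: pred_def)
  qed
  finally have [measurable]: "T \<in> sets borel" .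
  have bT: "boundary_fun f t = lim (\<lambda>n. f (of_real (x n) * cis t))" if "t \<in> T" for t
  proof -
    obtain L where L: "((\<lambda>r. f (of_real r * cis t)) \<longlongrightarrow> L) (at_left 1)" using \<open>t \<in> T\<close> by (auto simp: T_def)
    then have "boundary_fun f t = L" unfolding boundary_fun_def by (intro tendsto_Lim) auto
    moreover have "lim (\<lambda>n. f (of_real (x n) * cis t)) = L"
      by (intro limI filterlim_compose[OF L xlim])
    ultimately show ?thesis by simp
  qed
  have bnT: "boundary_fun f t = (THE L. False)" if "t \<notin> T" for t
  proof -
    have "((\<lambda>r. f (of_real r * cis t)) \<longlongrightarrow> L) (at_left 1) \<longleftrightarrow> False" for L
      using that by (auto simp: T_def)
    then show ?thesis unfolding boundary_fun_def Topological_Spaces.Lim_def by simp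
  qed
  have [measurable]: "(\<lambda>t. f (of_real (x n) * cis t)) \<in> borel_measurable borel" for n
    by (intro fm x1)
  have "boundary_fun f = (\<lambda>t. if t \<in> T then lim (\<lambda>n. f (of_real (x n) * cis t)) else (THE L. False))"
    using bT bnT by auto
  also have "\<dots> \<in> borel_measurable borel" by measurable
  finally show ?thesis .
qed

text \<open>Taylor polynomials are continuous up to the circle, so the oscillation of
  \<open>f\<close> near an endpoint is that of the Taylor tail \<open>h k\<close>. Its square means
  are at most the coefficient tail \<open>T k\<close>, which tends to 0.\<close>

theorem Fatou_radial_limit:
  assumes f: "f holomorphic_on ball 0 1"
    and B: "\<And>R. 0 < R \<Longrightarrow> R < 1 \<Longrightarrow> circ_square f R \<le> B"
  shows "AE t in circ_meas. ((\<lambda>r. f (of_real r * cis t)) \<longlongrightarrow> boundary_fun f t) (at_left 1)"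
proof -
  define a where "a n = (deriv ^^ n) f 0 / fact n" for n
  have a: "(\<lambda>n. a n * z ^ n) sums f z" if "norm z < 1" for z
    using holomorphic_power_series[OF f, of z] that by (simp add: a_def)
  have sa: "summable (\<lambda>n. (norm (a n))\<^sup>2)" by (rule summable_square_coeffs[OF a B])
  define p where "p k z = (\<Sum>n<k. a n * z ^ n)" for k z
  define h where "h k z = f z - p k z" for k z
  have holh: "h k holomorphic_on ball 0 1" for k
    unfolding h_def p_def by (intro holomorphic_intros f)
  define T where "T k = (\<Sum>n. (norm (a (n + k)))\<^sup>2)" for k
  have hsq: "circ_square (h k) R \<le> T k" if R: "0 < R" "R < 1" for k R
  proof -
    have hs: "(\<lambda>n. (if n < k then 0 else a n) * z ^ n) sums h k z" if z: "norm z < 1" for z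
    proof -
      have "(\<lambda>n. if n \<in> {..<k} then a n * z ^ n else 0) sums p k z"
        unfolding p_def by (rule sums_If_finite_set) simp
      from sums_diff[OF a[OF z] this] show ?thesis unfolding h_def
        by (rule sums_cong[THEN iffD1, rotated]) auto
    qed
    have "(\<lambda>n. (norm (if n < k then 0 else a n))\<^sup>2 * R ^ (2*n)) sums circ_square (h k) R"
      using hs R by (intro circ_square_sums) auto
    then have "(\<lambda>n. (norm (if n + k < k then 0 else a (n + k)))\<^sup>2 * R ^ (2*(n + k))) sums
       (circ_square (h k) R - (\<Sum>n<k. (norm (if n < k then 0 else a n))\<^sup>2 * R ^ (2*n)))"
      by (subst sums_iff_shift'[of "\<lambda>n. (norm (if n < k then 0 else a n))\<^sup>2 * R ^ (2*n)"])
    then have s: "(\<lambda>n. (norm (a (n + k)))\<^sup>2 * R ^ (2*(n + k))) sums circ_square (h k) R"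
      by simp
    show ?thesis unfolding T_def sums_unique[OF s]
    proof (rule suminf_le[OF _ sums_summable[OF s]])
      show "summable (\<lambda>n. (norm (a (n + k)))\<^sup>2)" using sa by (rule summable_ignore_initial_segment)
      show "(norm (a (n + k)))\<^sup>2 * R ^ (2 * (n + k)) \<le> (norm (a (n + k)))\<^sup>2" for n
        using R by (intro mult_left_le power_le_one) auto
    qed
  qed
  have T0: "T \<longlonglongrightarrow> 0" unfolding T_def by (rule suminf_exist_split2[OF sa])
  have ae: "AE t in circ_meas. \<exists>k. \<forall>r\<in>{0<..<1}. norm (h k (of_real r * cis t)) \<le> \<epsilon>" if \<epsilon>: "\<epsilon> > 0" for \<epsilon>
  proof -
    define E where "E k = {t. \<exists>r\<in>{0<..<1}. norm (h k (of_real r * cis t)) > \<epsilon>}" for k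
    have Em [measurable]: "E k \<in> sets borel" for k
      unfolding E_def by (rule maximal_inequality(1)[OF holh hsq \<epsilon>])
    have Ele: "measure circ_meas (E k) \<le> 256 * T k / \<epsilon>\<^sup>2" for k
      unfolding E_def by (rule maximal_inequality(2)[OF holh hsq \<epsilon>])
    \<comment> \<open>The exceptional angles, where every tail exceeds \<open>\<epsilon>\<close> at
      some radius, lie in all the \<open>E k\<close> at once; a vanishing bound for each k makes
      their set null.\<close>
    have "measure circ_meas (\<Inter>k. E k) \<le> 256 * T k / \<epsilon>\<^sup>2" for k
      by (rule order_trans[OF circ.finite_measure_mono Ele]) auto
    moreover have "(\<lambda>k. 256 * T k / \<epsilon>\<^sup>2) \<longlonglongrightarrow> 256 * 0 / \<epsilon>\<^sup>2"
      by (intro tendsto_intros T0) (use \<epsilon> in auto)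
    ultimately have "measure circ_meas (\<Inter>k. E k) \<le> 0"
      by (intro LIMSEQ_le_const[where X="\<lambda>k. 256 * T k / \<epsilon>\<^sup>2"]) auto
    then have "emeasure circ_meas (\<Inter>k. E k) = 0"
      by (simp add: circ.emeasure_eq_measure measure_le_0_iff)
    then have "(\<Inter>k. E k) \<in> null_sets circ_meas" by auto
    then show ?thesis
      by (rule AE_I') (auto simp: E_def not_le)
  qed
  have "AE t in circ_meas. \<forall>j. \<exists>k. \<forall>r\<in>{0<..<1}. norm (h k (of_real r * cis t)) \<le> inverse (real (Suc j))"
    unfolding AE_all_countable by (intro allI ae) simp
  then show ?thesis
  proof (rule AE_mp, intro AE_I2 impI)
    fix t assume t: "\<forall>j. \<exists>k. \<forall>r\<in>{0<..<1}. norm (h k (of_real r * cis t)) \<le> inverse (real (Suc j))"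
    have "\<exists>L. ((\<lambda>r. f (of_real r * cis t)) \<longlongrightarrow> L) (at_left 1)"
    proof (rule radial_Cauchy_limit)
      fix \<epsilon> :: real assume \<epsilon>: "\<epsilon> > 0"
      \<comment> \<open>A quarter for the tail and a quarter for the polynomial, at each of the two
        radii compared.\<close>
      obtain j where "inverse (real (Suc j)) < \<epsilon> / 4" using reals_Archimedean[of "\<epsilon>/4"] \<epsilon> by auto
      with t obtain k where k: "\<And>r. r \<in> {0<..<1} \<Longrightarrow> norm (h k (of_real r * cis t)) \<le> \<epsilon> / 4"
        by (meson less_imp_le order_trans)
      have "((\<lambda>r. p k (of_real r * cis t)) \<longlongrightarrow> p k (of_real 1 * cis t)) (at_left 1)"
        unfolding p_def by (intro tendsto_intros)
      then have "\<forall>\<^sub>F r in at_left 1. dist (p k (of_real r * cis t)) (p k (of_real 1 * cis t)) < \<epsilon> / 4"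
        using \<epsilon> by (intro tendstoD) auto
      then obtain b where b: "b < 1" "\<And>r. b < r \<Longrightarrow> r < 1 \<Longrightarrow> dist (p k (of_real r * cis t)) (p k (of_real 1 * cis t)) < \<epsilon> / 4"
        unfolding eventually_at_left_field by auto
      show "\<exists>\<delta><1. \<forall>r\<in>{\<delta><..<1}. \<forall>s\<in>{\<delta><..<1}. dist (f (of_real r * cis t)) (f (of_real s * cis t)) \<le> \<epsilon>"
      proof (intro exI[of _ "max b 0"] conjI ballI)
        fix r s assume r: "r \<in> {max b 0<..<1}" and s: "s \<in> {max b 0<..<1}"
        have fr: "f (of_real u * cis t) = h k (of_real u * cis t) + p k (of_real u * cis t)" for u
          by (simp add: h_def)
        have u: "dist (f (of_real u * cis t)) (p k (of_real 1 * cis t)) \<le> \<epsilon> / 2" if "u \<in> {max b 0<..<1}" for u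
        proof -
          have "dist (f (of_real u * cis t)) (p k (of_real 1 * cis t)) \<le>
              norm (h k (of_real u * cis t)) + dist (p k (of_real u * cis t)) (p k (of_real 1 * cis t))"
            unfolding fr dist_norm by (metis add_diff_eq norm_triangle_ineq)
          then show ?thesis using k[of u] b(2)[of u] that by auto
        qed
        show "dist (f (of_real r * cis t)) (f (of_real s * cis t)) \<le> \<epsilon>"
          using u[OF r] u[OF s] dist_triangle2[of "f (of_real r * cis t)" "f (of_real s * cis t)" "p k (of_real 1 * cis t)"]
          by linarith
      qed (use b in auto)
    qed
    then obtain L where L: "((\<lambda>r. f (of_real r * cis t)) \<longlongrightarrow> L) (at_left 1)" ..
    then have "boundary_fun f t = L"
      unfolding boundary_fun_def by (intro tendsto_Lim) auto
    then show "((\<lambda>r. f (of_real r * cis t)) \<longlongrightarrow> boundary_fun f t) (at_left 1)" using L by simp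
  qed
qed

section \<open>Orlicz functions and the pointwise bound\<close>

locale orlicz =
  fixes Psi :: "real \<Rightarrow> real"
  assumes orlicz: "orlicz_function Psi"
begin

abbreviation Inv :: "real \<Rightarrow> real" where "Inv \<equiv> the_inv_into {0..} Psi"

lemma Psi_cont: "continuous_on {0..} Psi"
  and Psi_strict_mono: "strict_mono_on {0..} Psi"
  and Psi_0 [simp]: "Psi 0 = 0"
  and Psi_div_at_top: "filterlim (\<lambda>x. Psi x / x) at_top at_top"
  using orlicz by (auto simp: orlicz_function_def)

lemma Psi_less: "0 \<le> x \<Longrightarrow> x < y \<Longrightarrow> Psi x < Psi y"
  using strict_mono_onD[OF Psi_strict_mono, of x y] by auto

lemma Psi_mono: "0 \<le> x \<Longrightarrow> x \<le> y \<Longrightarrow> Psi x \<le> Psi y"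
  using Psi_less[of x y] by (cases "x = y") auto

lemma Psi_nonneg: "0 \<le> x \<Longrightarrow> 0 \<le> Psi x"
  using Psi_mono[of 0 x] by simp

lemma Psi_pos: "0 < x \<Longrightarrow> 0 < Psi x"
  using Psi_less[of 0 x] by simp

lemma Psi_le_iff: "0 \<le> x \<Longrightarrow> 0 \<le> y \<Longrightarrow> Psi x \<le> Psi y \<longleftrightarrow> x \<le> y"
  by (meson Psi_less Psi_mono not_le)

text \<open>Convexity on the segment from the origin, where \<open>Psi\<close> vanishes. It trades a
  factor inside \<open>Psi\<close> for the same factor outside, which is how modulars are rescaled
  to be at most 1.\<close>

lemma Psi_scale_le:
  assumes "0 \<le> u" "u \<le> 1" "0 \<le> y" shows "Psi (u * y) \<le> u * Psi y"
proof (cases "u = 0 \<or> u = 1 \<or> y = 0")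
  case False
  moreover have "\<forall>x\<in>{0..}. \<forall>y\<in>{0..}. \<forall>u\<in>{0<..<1}. x \<noteq> y \<longrightarrow>
      Psi ((1 - u) * x + u * y) < (1 - u) * Psi x + u * Psi y"
    using orlicz by (simp add: orlicz_function_def)
  from this[THEN bspec, of 0, THEN bspec, of y, THEN bspec, of u]
  have "0 \<noteq> y \<Longrightarrow> u \<in> {0<..<1} \<Longrightarrow> Psi ((1 - u) * 0 + u * y) < (1 - u) * Psi 0 + u * Psi y"
    using assms by simp
  ultimately have "Psi ((1 - u) * 0 + u * y) < (1 - u) * Psi 0 + u * Psi y"
    using assms by auto
  then show ?thesis by simp
qed auto

lemma Psi_at_top: "filterlim Psi at_top at_top"
proof -
  have "\<forall>\<^sub>F x in at_top. Psi x / x \<ge> 1"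
    using Psi_div_at_top by (simp add: filterlim_at_top)
  then have "\<forall>\<^sub>F x in at_top. x \<le> Psi x"
    using eventually_gt_at_top[of 0] by eventually_elim (simp add: field_simps)
  then show ?thesis
    by (rule filterlim_at_top_mono[OF filterlim_ident])
qed

lemma Psi_surj:
  assumes "0 \<le> y" shows "\<exists>x\<ge>0. Psi x = y"
proof -
  have "\<forall>\<^sub>F x in at_top. Psi x \<ge> y" using Psi_at_top by (simp add: filterlim_at_top)
  then have "\<forall>\<^sub>F x in at_top. Psi x \<ge> y \<and> 0 \<le> x"
    using eventually_ge_at_top by (rule eventually_conj)
  then obtain b where b: "Psi b \<ge> y" "0 \<le> b"
    by (auto simp: eventually_at_top_linorder)
  have "\<exists>x\<ge>0. x \<le> b \<and> Psi x = y"
    using assms b continuous_on_subset[OF Psi_cont, of "{0..b}"] by (intro IVT') auto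
  then show ?thesis by auto
qed

lemma Psi_inj: "inj_on Psi {0..}"
  using Psi_strict_mono by (rule strict_mono_on_imp_inj_on)

lemma
  assumes "0 \<le> y"
  shows Psi_Inv [simp]: "Psi (Inv y) = y" and Inv_nonneg: "0 \<le> Inv y"
proof -
  obtain x where "x \<ge> 0" "Psi x = y" using Psi_surj[OF assms] by auto
  then have "Inv y = x" by (auto intro!: the_inv_into_f_eq[OF Psi_inj])
  then show "Psi (Inv y) = y" "0 \<le> Inv y" using \<open>x \<ge> 0\<close> \<open>Psi x = y\<close> by auto
qed

lemma Inv_le_iff: "0 \<le> y \<Longrightarrow> 0 \<le> x \<Longrightarrow> Inv y \<le> x \<longleftrightarrow> y \<le> Psi x"
  using Psi_le_iff[of "Inv y" x] Inv_nonneg by simp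

lemma less_Inv_iff: "0 \<le> y \<Longrightarrow> 0 \<le> x \<Longrightarrow> x < Inv y \<longleftrightarrow> Psi x < y"
  using Inv_le_iff[of y x] by auto

lemma Inv_pos: "0 < y \<Longrightarrow> 0 < Inv y"
  by (simp add: less_Inv_iff)

lemma Inv_mono: "0 \<le> x \<Longrightarrow> x \<le> y \<Longrightarrow> Inv x \<le> Inv y"
  by (simp add: Inv_le_iff Inv_nonneg)

text \<open>Negative arguments of \<open>Psi\<close> are uncontrolled, so measurability is taken
  from the continuous function \<open>Psi (max 0 x)\<close>.\<close>

lemma Psi_measurable [measurable (raw)]:
  assumes [measurable]: "f \<in> borel_measurable M" and "\<And>x. 0 \<le> f x"
  shows "(\<lambda>x. Psi (f x)) \<in> borel_measurable M"
proof -
  have "continuous_on UNIV (\<lambda>x. Psi (max 0 x))"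
    by (intro continuous_on_compose2[OF Psi_cont] continuous_intros) auto
  then have "(\<lambda>x. Psi (max 0 x)) \<in> borel_measurable borel" by (rule borel_measurable_continuous_onI)
  from measurable_compose[OF assms(1) this] show ?thesis using assms(2) by (simp add: max_absorb2)
qed

lemma Inv_measurable [measurable (raw)]:
  assumes "f \<in> borel_measurable M" and "\<And>x. 0 \<le> f x"
  shows "(\<lambda>x. Inv (f x)) \<in> borel_measurable M"
proof -
  have "mono (\<lambda>y. Inv (max 0 y))"
    by (intro monoI Inv_mono) auto
  then have "(\<lambda>y. Inv (max 0 y)) \<in> borel_measurable borel" by (rule borel_measurable_mono)
  from measurable_compose[OF assms(1) this] show ?thesis using assms(2) by (simp add: max_absorb2)
qed

lemma modular_mono:
  assumes "\<And>t. norm (f t) \<le> norm (g t)"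
  shows "orlicz_modular Psi f \<le> orlicz_modular Psi g"
  unfolding orlicz_modular_def by (intro nn_integral_mono ennreal_leI Psi_mono assms) auto

text \<open>The strict inequality provides an admissible constant below C without knowing that the
  infimum is attained. A function of norm at most 1 is therefore divided by 2 later on.\<close>

lemma modular_le_1_of_lux_norm:
  assumes "in_LPsi Psi g" "lux_norm Psi g < C"
  shows "orlicz_modular Psi (\<lambda>t. g t / of_real C) \<le> 1"
proof -
  have "{C. C > 0 \<and> orlicz_modular Psi (\<lambda>t. g t / of_real C) \<le> 1} \<noteq> {}"
    using assms(1) by (auto simp: in_LPsi_def)
  from cInf_lessD[OF this] assms(2) obtain D
    where D: "D > 0" "orlicz_modular Psi (\<lambda>t. g t / of_real D) \<le> 1" "D < C"
    by (auto simp: lux_norm_def)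
  have "orlicz_modular Psi (\<lambda>t. g t / of_real C) \<le> orlicz_modular Psi (\<lambda>t. g t / of_real D)"
    using D by (intro modular_mono) (auto simp: norm_divide intro!: divide_left_mono)
  then show ?thesis using D by simp
qed

lemma lux_norm_le:
  assumes "C > 0" "orlicz_modular Psi (\<lambda>t. g t / of_real C) \<le> 1"
  shows "lux_norm Psi g \<le> C"
  unfolding lux_norm_def using assms by (intro cInf_lower bdd_belowI[of _ 0]) auto

text \<open>Superlinear growth gives \<open>x \<le> Psi x\<close> eventually, so
  \<open>Delta1\<close> gives \<open>x^2 \<le> x * Psi x \<le> Psi (b * x)\<close> for large x. This
  is the source of the inclusion of the Orlicz space in L^2.\<close>

lemma Delta1_square:
  assumes "Delta1 Psi"
  shows "\<exists>b>0. \<exists>x0\<ge>0. \<forall>x\<ge>0. x\<^sup>2 \<le> x0\<^sup>2 + Psi (b * x)"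
proof -
  obtain b where b: "b > 1" "\<forall>\<^sub>F x in at_top. x * Psi x \<le> Psi (b * x)"
    using assms by (auto simp: Delta1_def)
  have "\<forall>\<^sub>F x in at_top. Psi x / x \<ge> 1"
    using Psi_div_at_top by (simp add: filterlim_at_top)
  then have "\<forall>\<^sub>F x in at_top. x\<^sup>2 \<le> Psi (b * x)"
    using eventually_gt_at_top[of 0] b(2)
  proof eventually_elim
    case (elim x)
    then have "x \<le> Psi x" by (simp add: field_simps)
    then have "x * x \<le> x * Psi x" using elim by (intro mult_left_mono) auto
    then show ?case using elim unfolding power2_eq_square by linarith
  qed
  then obtain x1 where x1: "\<And>x. x \<ge> x1 \<Longrightarrow> x\<^sup>2 \<le> Psi (b * x)"
    by (auto simp: eventually_at_top_linorder)
  define x0 where "x0 = max x1 0"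
  have "x\<^sup>2 \<le> x0\<^sup>2 + Psi (b * x)" if "x \<ge> 0" for x
  proof (cases "x \<ge> x1")
    case True then show ?thesis using x1[of x] by (simp add: add_increasing)
  next
    case False
    then have "x\<^sup>2 \<le> x0\<^sup>2" using that by (intro power_mono) (auto simp: x0_def)
    then show ?thesis using Psi_nonneg[of "b * x"] that b by simp
  qed
  then show ?thesis using b by (intro exI[of _ b] conjI exI[of _ x0]) (auto simp: x0_def)
qed

text \<open>The quadratic bound is integrated at x = |f| / (b C), with C just above the supremum of
  the norms on circles; this places f in H^2, where Fatou's theorem is available.\<close>

lemma in_HPsi_circ_square_bounded:
  assumes D: "Delta1 Psi" and f: "in_HPsi Psi f"
  shows "\<exists>B. \<forall>R. 0 < R \<longrightarrow> R < 1 \<longrightarrow> circ_square f R \<le> B"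
proof -
  obtain b x0 where b: "b > 0" "x0 \<ge> 0" "\<And>x. x \<ge> 0 \<Longrightarrow> x\<^sup>2 \<le> x0\<^sup>2 + Psi (b * x)"
    using Delta1_square[OF D] by auto
  obtain K where K: "\<And>r. 0 < r \<Longrightarrow> r < 1 \<Longrightarrow> in_LPsi Psi (\<lambda>t. f (of_real r * cis t))"
      "\<And>r. 0 < r \<Longrightarrow> r < 1 \<Longrightarrow> lux_norm Psi (\<lambda>t. f (of_real r * cis t)) \<le> K"
    and hol: "f holomorphic_on ball 0 1"
    using f unfolding in_HPsi_def by (metis greaterThanLessThan_iff)
  define C where "C = max K 0 + 1"
  have C: "C > 0" "K < C" by (auto simp: C_def)
  define B where "B = (b * C)\<^sup>2 * (x0\<^sup>2 + 1)"
  have "circ_square f R \<le> B" if R: "0 < R" "R < 1" for R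
    unfolding circ_square_def
  proof (rule integral_real_bounded)
    show "0 \<le> B" by (simp add: B_def)
    let ?f = "\<lambda>t. f (of_real R * cis t)"
    have [measurable]: "?f \<in> borel_measurable borel"
      using R by (intro borel_measurable_continuous_onI continuous_on_circle hol) auto
    have m: "orlicz_modular Psi (\<lambda>t. ?f t / of_real C) \<le> 1"
      using K(2)[OF R] C by (intro modular_le_1_of_lux_norm K(1) R) auto
    have pt: "(norm (?f t))\<^sup>2 \<le> (b * C)\<^sup>2 * (x0\<^sup>2 + Psi (norm (?f t / of_real C)))" for t
    proof -
      have "(norm (?f t) / (b * C))\<^sup>2 \<le> x0\<^sup>2 + Psi (b * (norm (?f t) / (b * C)))"
        using b C by (intro b(3)) auto
      also have "b * (norm (?f t) / (b * C)) = norm (?f t / of_real C)"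
        using b C by (simp add: norm_divide)
      finally show ?thesis using b C by (simp add: power_divide field_simps)
    qed
    have "(\<integral>\<^sup>+t. ennreal ((norm (?f t))\<^sup>2) \<partial>circ_meas)
        \<le> (\<integral>\<^sup>+t. ennreal ((b * C)\<^sup>2) * (ennreal (x0\<^sup>2) + ennreal (Psi (norm (?f t / of_real C)))) \<partial>circ_meas)"
      using pt by (intro nn_integral_mono)
        (simp add: ennreal_mult[symmetric] ennreal_plus[symmetric] Psi_nonneg del: ennreal_plus)
    also have "\<dots> = ennreal ((b * C)\<^sup>2) * (ennreal (x0\<^sup>2) + orlicz_modular Psi (\<lambda>t. ?f t / of_real C))"
      unfolding orlicz_modular_def
      by (simp add: nn_integral_cmult nn_integral_add emeasure_circ_UNIV)
    also have "\<dots> \<le> ennreal ((b * C)\<^sup>2) * (ennreal (x0\<^sup>2) + 1)"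
      using m by (intro mult_left_mono add_left_mono) auto
    also have "\<dots> = ennreal B"
      unfolding B_def by (simp add: ennreal_mult)
    finally show "(\<integral>\<^sup>+t. ennreal ((norm (?f t))\<^sup>2) \<partial>circ_meas) \<le> ennreal B" .
  qed
  then show ?thesis by blast
qed

text \<open>With \<open>y = Inv (1 / (1 - norm z))\<close> the kernel is at most
  \<open>2 * Psi y\<close>. Boundary values up to 2 y are averaged against a kernel of mass 1;
  larger ones are compared with \<open>Psi\<close> by convexity, and \<open>Psi y\<close> cancels
  against the size of the kernel.\<close>

lemma pointwise_bound:
  assumes D: "Delta1 Psi" and f: "f \<in> HPsi_unit_ball Psi" and z: "norm z < 1"
  shows "norm (f z) \<le> 6 * Inv (1 / (1 - norm z))"
proof -
  define y where "y = Inv (1 / (1 - norm z))"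
  have Py: "Psi y = 1 / (1 - norm z)" and y0: "0 < y"
    unfolding y_def using z by (simp_all add: Inv_pos)
  have Hf: "in_HPsi Psi f" and hol: "f holomorphic_on ball 0 1"
    and Lf: "in_LPsi Psi (boundary_fun f)" and lux: "lux_norm Psi (boundary_fun f) \<le> 1"
    using f by (auto simp: HPsi_unit_ball_def in_HPsi_def)
  obtain B where B: "\<And>R. 0 < R \<Longrightarrow> R < 1 \<Longrightarrow> circ_square f R \<le> B"
    using in_HPsi_circ_square_bounded[OF D Hf] by blast
  have lim: "AE t in circ_meas. ((\<lambda>r. f (of_real r * cis t)) \<longlongrightarrow> boundary_fun f t) (at_left 1)"
    by (rule Fatou_radial_limit[OF hol B])
  have [measurable]: "boundary_fun f \<in> borel_measurable borel" by (rule boundary_fun_measurable[OF hol])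
  define x where "x n = 1 - inverse (real (Suc (Suc n)))" for n
  have x: "x \<longlonglongrightarrow> 1"
    unfolding x_def using tendsto_diff[OF tendsto_const LIMSEQ_Suc[OF LIMSEQ_inverse_real_of_nat], of 1] by simp
  have x1: "0 < x n" "x n < 1" for n by (simp_all add: x_def inverse_less_1_iff)
  have xlim: "filterlim x (at_left 1) sequentially"
    using x x1 by (auto simp: filterlim_at less_imp_neq)
  have fm [measurable]: "(\<lambda>t. f (of_real (x n) * cis t)) \<in> borel_measurable borel" for n
    using x1[of n] by (intro borel_measurable_continuous_onI continuous_on_circle hol) auto
  define b where "b = 2 / (1 - norm z)"
  have b: "0 < b" "b = 2 * Psi y" using z Py by (auto simp: b_def)
  have P0: "0 \<le> poisson z t" and Pb: "poisson z t \<le> b" for t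
    using poisson_pos[OF z, of t] poisson_le[OF z, of t] by (auto simp: b_def)
  \<comment> \<open>Truncation at N: values above N satisfy |f| \<le> |f|^2 / N, so the H^2 bound
    makes the error uniform in the dilate, while the truncated part passes to boundary values by
    dominated convergence.\<close>
  have main: "norm (f z) \<le> 6 * y + b * B / N" if N: "N > 0" for N
  proof -
    define m where "m n t = poisson z t * min (norm (f (of_real (x n) * cis t))) N" for n t
    define m' where "m' t = poisson z t * min (norm (boundary_fun f t)) N" for t
    have [measurable]: "m n \<in> borel_measurable borel" for n unfolding m_def by measurable
    have [measurable]: "m' \<in> borel_measurable borel" unfolding m'_def by measurable
    have mb: "norm (m n t) \<le> b * N" for n t
      unfolding m_def norm_mult using P0[of t] Pb[of t] b N by (intro mult_mono) auto
    have 1: "norm (f (of_real (x n) * z)) \<le> (\<integral>t. m n t \<partial>circ_meas) + b * B / N" for n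
    proof -
      let ?f = "\<lambda>t. f (of_real (x n) * cis t)"
      have "compact ((\<lambda>w. f (of_real (x n) * w)) ` sphere 0 1)"
        using x1[of n] by (intro compact_continuous_image continuous_on_compose2[OF holomorphic_on_imp_continuous_on[OF hol]] continuous_intros)
          (auto simp: norm_mult)
      then obtain M where "\<forall>w\<in>(\<lambda>w. f (of_real (x n) * w)) ` sphere 0 1. norm w \<le> M"
        using compact_imp_bounded bounded_iff by blast
      then have "norm (?f t) \<le> M" for t by auto
      then have intf: "integrable circ_meas (\<lambda>t. (norm (?f t))\<^sup>2)"
        by (intro circ_integrable_bounded[where B="M\<^sup>2"]) (auto intro: power_mono)
      have intm: "integrable circ_meas (m n)"
        using mb by (intro circ_integrable_bounded) auto
      have "(\<lambda>w. f (of_real (x n) * w)) holomorphic_on ball 0 (1 / x n)"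
        using x1[of n] by (intro holomorphic_on_compose_gen[OF _ hol, unfolded o_def] holomorphic_intros)
          (auto simp: norm_mult field_simps)
      from circ_poisson[OF this _ z]
      have "f (of_real (x n) * z) = (\<integral>t. poisson z t * ?f t \<partial>circ_meas)"
        using x1[of n] by simp
      also have "norm \<dots> \<le> (\<integral>t. norm (poisson z t * ?f t) \<partial>circ_meas)" by (rule integral_norm_bound)
      also have "\<dots> \<le> (\<integral>t. m n t + b / N * (norm (?f t))\<^sup>2 \<partial>circ_meas)"
      proof (rule integral_mono')
        show "integrable circ_meas (\<lambda>t. m n t + b / N * (norm (?f t))\<^sup>2)" using intf intm by auto
        show "norm (poisson z t * ?f t) \<le> m n t + b / N * (norm (?f t))\<^sup>2" for t
        proof -
          have "norm (?f t) \<le> min (norm (?f t)) N + (norm (?f t))\<^sup>2 / N"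
          proof (cases "norm (?f t) \<le> N")
            case False
            then have "norm (?f t) * N \<le> norm (?f t) * norm (?f t)" by (intro mult_left_mono) auto
            then have "norm (?f t) \<le> (norm (?f t))\<^sup>2 / N" using N by (simp add: field_simps power2_eq_square)
            then show ?thesis using N False by simp
          qed (use N in simp)
          then have "poisson z t * norm (?f t) \<le> poisson z t * (min (norm (?f t)) N + (norm (?f t))\<^sup>2 / N)"
            using P0 by (rule mult_left_mono)
          also have "\<dots> = m n t + poisson z t * ((norm (?f t))\<^sup>2 / N)"
            by (simp add: m_def algebra_simps)
          also have "\<dots> \<le> m n t + b * ((norm (?f t))\<^sup>2 / N)"
            using Pb N by (intro add_left_mono mult_right_mono) auto
          finally show ?thesis using P0[of t] by (simp add: norm_mult)
        qed
        then show "0 \<le> m n t + b / N * (norm (?f t))\<^sup>2" for t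
          using norm_ge_zero order_trans by blast
      qed
      also have "\<dots> \<le> (\<integral>t. m n t \<partial>circ_meas) + b * B / N"
      proof -
        have "(\<integral>t. m n t + b / N * (norm (?f t))\<^sup>2 \<partial>circ_meas) = (\<integral>t. m n t \<partial>circ_meas) + b / N * circ_square f (x n)"
          using intf intm by (simp add: circ_square_def)
        also have "b / N * circ_square f (x n) \<le> b / N * B"
          using b N B[OF x1] by (intro mult_left_mono) auto
        finally show ?thesis by simp
      qed
      finally show ?thesis .
    qed
    have "(\<lambda>n. \<integral>t. m n t \<partial>circ_meas) \<longlonglongrightarrow> (\<integral>t. m' t \<partial>circ_meas)"
    proof (rule integral_dominated_convergence[where w="\<lambda>_. b * N"])
      show "AE t in circ_meas. (\<lambda>n. m n t) \<longlonglongrightarrow> m' t"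
        using lim
      proof eventually_elim
        case (elim t)
        have "(\<lambda>n. f (of_real (x n) * cis t)) \<longlonglongrightarrow> boundary_fun f t"
          by (rule filterlim_compose[OF elim xlim])
        then show ?case unfolding m_def m'_def by (intro tendsto_intros)
      qed
      show "AE t in circ_meas. norm (m n t) \<le> b * N" for n using mb by simp
    qed auto
    moreover have "(\<lambda>n. norm (f (of_real (x n) * z))) \<longlonglongrightarrow> norm (f z)"
    proof -
      have "isCont f z"
        using z hol holomorphic_on_imp_continuous_on continuous_on_interior by force
      moreover have "(\<lambda>n. of_real (x n) * z) \<longlonglongrightarrow> z"
        using tendsto_mult[OF tendsto_of_real[OF x] tendsto_const[of z]] by simp
      ultimately show ?thesis by (intro tendsto_norm) (rule isCont_tendsto_compose)
    qed
    ultimately have "norm (f z) \<le> (\<integral>t. m' t \<partial>circ_meas) + b * B / N"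
      using 1 by (intro LIMSEQ_le[OF _ tendsto_add[OF _ tendsto_const]]) auto
    moreover have "(\<integral>t. m' t \<partial>circ_meas) \<le> 6 * y"
    proof (rule integral_real_bounded)
      \<comment> \<open>Division by 2 because norm at most 1 controls the modular here only for
        constants above 1.\<close>
      define G where "G t = Psi (norm (boundary_fun f t / of_real 2))" for t
      have G0: "0 \<le> G t" for t by (simp add: G_def Psi_nonneg)
      have [measurable]: "G \<in> borel_measurable borel" unfolding G_def by measurable
      have intG: "(\<integral>\<^sup>+t. ennreal (G t) \<partial>circ_meas) \<le> 1"
        using modular_le_1_of_lux_norm[OF Lf, of 2] lux by (simp add: orlicz_modular_def G_def)
      have pt: "m' t \<le> poisson z t * (2 * y) + 4 * y * G t" for t
      proof -
        \<comment> \<open>Beyond 2 y, the quotient \<open>Psi v / v\<close> at half the modulus is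
          at least \<open>Psi y / y\<close>, so v is at most y times
          \<open>Psi v / Psi y\<close>.\<close>
        have "norm (boundary_fun f t) \<le> 2 * y + 2 * y * (G t / Psi y)"
        proof (cases "norm (boundary_fun f t) \<le> 2 * y")
          case True
          have "0 \<le> 2 * y * (G t / Psi y)" using y0 G0[of t] Psi_pos[of y] by simp
          with True show ?thesis by linarith
        next
          case False
          define v where "v = norm (boundary_fun f t) / 2"
          have v: "y < v" using False by (simp add: v_def)
          have "Psi (y / v * v) \<le> y / v * Psi v" using v y0 by (intro Psi_scale_le) auto
          then have "v * Psi y \<le> y * Psi v" using v y0 by (simp add: field_simps)
          then have "v \<le> y * (Psi v / Psi y)" using Psi_pos[of y] y0 by (simp add: field_simps)
          moreover have "Psi v = G t" by (simp add: v_def G_def norm_divide)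
          ultimately have "v \<le> y * (G t / Psi y)" by simp
          moreover have "norm (boundary_fun f t) = 2 * v" by (simp add: v_def)
          ultimately show ?thesis using y0 by linarith
        qed
        then have "m' t \<le> poisson z t * (2 * y + 2 * y * (G t / Psi y))"
          unfolding m'_def using P0 by (intro mult_left_mono) auto
        also have "\<dots> = poisson z t * (2 * y) + poisson z t * (2 * y * (G t / Psi y))"
          by (simp add: algebra_simps)
        also have "\<dots> \<le> poisson z t * (2 * y) + b * (2 * y * (G t / Psi y))"
          using Pb y0 G0[of t] Psi_pos[of y] by (intro add_left_mono mult_right_mono) auto
        also have "b * (2 * y * (G t / Psi y)) = 4 * y * G t"
          using b Psi_pos[of y] y0 by simp
        finally show ?thesis .
      qed
      have "(\<integral>\<^sup>+t. ennreal (m' t) \<partial>circ_meas)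
        \<le> (\<integral>\<^sup>+t. ennreal (poisson z t) * ennreal (2 * y) + ennreal (4 * y) * ennreal (G t) \<partial>circ_meas)"
        using pt P0 G0 y0 by (intro nn_integral_mono)
          (simp add: ennreal_mult[symmetric] ennreal_plus[symmetric] del: ennreal_plus)
      also have "\<dots> = (\<integral>\<^sup>+t. ennreal (poisson z t) \<partial>circ_meas) * ennreal (2 * y)
          + ennreal (4 * y) * (\<integral>\<^sup>+t. ennreal (G t) \<partial>circ_meas)"
        by (simp add: nn_integral_add nn_integral_cmult nn_integral_multc)
      also have "\<dots> \<le> 1 * ennreal (2 * y) + ennreal (4 * y) * 1"
        unfolding nn_integral_poisson[OF z] using intG by (intro add_left_mono mult_left_mono) auto
      also have "\<dots> = ennreal (6 * y)"
        using y0 by (simp add: ennreal_plus[symmetric] del: ennreal_plus)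
      finally show "(\<integral>\<^sup>+t. ennreal (m' t) \<partial>circ_meas) \<le> ennreal (6 * y)" .
    qed (use y0 in simp)
    ultimately show ?thesis by simp
  qed
  have "((\<lambda>N. 6 * y + b * B / N) \<longlongrightarrow> 6 * y + 0) at_top"
    by (intro tendsto_add tendsto_const tendsto_divide_0[OF tendsto_const] filterlim_at_top_imp_at_infinity filterlim_ident)
  moreover have "\<forall>\<^sub>F N in at_top. norm (f z) \<le> 6 * y + b * B / N"
    using eventually_gt_at_top[of 0] by eventually_elim (rule main)
  ultimately have "norm (f z) \<le> 6 * y + 0"
    by (intro tendsto_lowerbound[where F="at_top :: real filter"]) auto
  then show ?thesis by (simp add: y_def)
qed

end

section \<open>Necessity\<close>

text \<open>A self-map of the disc has square means at most 1, so Fatou's theorem applies to it for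
  every \<open>Psi\<close>; the necessity half relies on this.\<close>

lemma self_map_radial_limit:
  assumes phi: "phi holomorphic_on ball 0 1" "phi ` ball 0 1 \<subseteq> ball 0 1"
  shows "AE t in circ_meas. ((\<lambda>r. phi (of_real r * cis t)) \<longlongrightarrow> boundary_fun phi t) (at_left 1)"
proof (rule Fatou_radial_limit[OF phi(1)])
  fix R :: real assume R: "0 < R" "R < 1"
  have "(norm (phi (of_real R * cis t)))\<^sup>2 \<le> 1" for t
  proof -
    have "phi (of_real R * cis t) \<in> ball 0 1" using R phi(2) by (auto simp: norm_mult image_subset_iff)
    then show ?thesis by (simp add: abs_square_le_1)
  qed
  then have "\<bar>\<integral>t. (norm (phi (of_real R * cis t)))\<^sup>2 \<partial>circ_meas\<bar> \<le> 1"
    by (intro circ_integral_abs_le) simp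
  then show "circ_square phi R \<le> 1" by (simp add: circ_square_def)
qed

lemma radial_limit_norm_le_1:
  assumes phi: "phi ` ball 0 1 \<subseteq> ball 0 1"
    and lim: "((\<lambda>r. phi (of_real r * cis t)) \<longlongrightarrow> w) (at_left 1)"
  shows "norm (w::complex) \<le> 1"
proof (rule tendsto_upperbound)
  show "((\<lambda>r. norm (phi (of_real r * cis t))) \<longlongrightarrow> norm w) (at_left 1)"
    by (intro tendsto_norm lim)
  show "\<forall>\<^sub>F r in at_left 1. norm (phi (of_real r * cis t)) \<le> 1"
    using eventually_at_left_real[OF zero_less_one]
    by eventually_elim (use phi in \<open>auto simp: norm_mult image_subset_iff less_imp_le\<close>)
qed auto

text \<open>Continuity at the limit point has two sources: test functions are analytic past the
  closed disc, whereas members of the unit ball are evaluated only at interior points.\<close>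

lemma boundary_fun_compose:
  assumes "((\<lambda>r. phi (of_real r * cis t)) \<longlongrightarrow> w) (at_left 1)" "isCont f w"
  shows "boundary_fun (f \<circ> phi) t = f w"
  unfolding boundary_fun_def o_def
  by (intro tendsto_Lim isCont_tendsto_compose[OF assms(2,1)]) auto

context orlicz
begin

text \<open>
  On the circle \<open>\<bar>l / (1 - (1 - l) * cis (- s) * z)\<bar>\<^sup>2\<close> is at most 1 and at most \<open>l\<close> times the Poisson kernel
  at \<open>(1 - l) * cis s\<close>; convexity of \<open>Psi\<close> then bounds the modular of \<open>test_fun\<close> by 1.
\<close>
definition test_fun :: "real \<Rightarrow> real \<Rightarrow> complex \<Rightarrow> complex" where
  "test_fun l s z = of_real (Inv (1 / l)) * (of_real l / (1 - of_real (1 - l) * cis (- s) * z))\<^sup>2"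

text \<open>The pole has modulus \<open>1 / (1 - l)\<close>. Hence the boundary function is plain
  restriction to the circle, and evaluation at a boundary value of \<open>phi\<close> makes sense
  even when its modulus is 1.\<close>

lemma
  assumes l: "0 < l" "l < 1"
  shows holomorphic_test_fun: "test_fun l s holomorphic_on ball 0 (1 / (1 - l))"
    and test_fun_in_unit_ball: "test_fun l s \<in> HPsi_unit_ball Psi"
proof -
  define q where "q = 1 - l"
  have q: "0 < q" "q < 1" using l by (auto simp: q_def)
  define den where "den z = 1 - of_real q * cis (- s) * z" for z
  have den_ge: "1 - q * norm z \<le> norm (den z)" for z
    using norm_triangle_ineq2[of 1 "of_real q * cis (-s) * z"] q by (simp add: den_def norm_mult)
  have nz: "den z \<noteq> 0" if "norm z < 1 / q" for z
    using den_ge[of z] that q by (auto simp: field_simps)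
  define y where "y = Inv (1 / l)"
  have y: "0 < y" "Psi y = 1 / l" using l by (auto simp: y_def Inv_pos)
  have f_eq: "test_fun l s z = of_real y * (of_real l / den z)\<^sup>2" for z
    by (simp add: test_fun_def y_def den_def q_def)
  show hol: "test_fun l s holomorphic_on ball 0 (1 / (1 - l))"
    unfolding f_eq[abs_def] using nz unfolding den_def q_def[symmetric]
    by (intro holomorphic_intros) auto
  have hol1: "test_fun l s holomorphic_on ball 0 1"
    using l by (intro holomorphic_on_subset[OF hol] subset_ball) (simp add: field_simps)
  have norm_f: "norm (test_fun l s z) = (l / norm (den z))\<^sup>2 * y" for z
    using y l by (simp add: f_eq norm_mult norm_power norm_divide)
  have u: "0 \<le> (l / norm (den z))\<^sup>2" "(l / norm (den z))\<^sup>2 \<le> 1" if "norm z \<le> 1" for z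
  proof -
    have "q * norm z \<le> q * 1" using that q by (intro mult_left_mono) auto
    then have "l \<le> norm (den z)" using den_ge[of z] by (simp add: q_def)
    then show "0 \<le> (l / norm (den z))\<^sup>2" "(l / norm (den z))\<^sup>2 \<le> 1"
      using l by (auto intro!: power_le_one simp: divide_le_eq_1_pos[OF less_le_trans[of 0 l]])
  qed
  have bf: "boundary_fun (test_fun l s) t = test_fun l s (cis t)" for t
  proof -
    have "continuous_on (ball 0 (1 / (1 - l))) (test_fun l s)"
      using hol by (rule holomorphic_on_imp_continuous_on)
    moreover have "cis t \<in> ball 0 (1 / (1 - l))" using l by (simp add: field_simps)
    ultimately have "isCont (test_fun l s) (cis t)"
      by (simp add: continuous_on_eq_continuous_at)
    moreover have "((\<lambda>r. of_real r * cis t) \<longlongrightarrow> cis t) (at_left 1)"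
      by (auto intro!: tendsto_eq_intros)
    ultimately have "((\<lambda>r. test_fun l s (of_real r * cis t)) \<longlongrightarrow> test_fun l s (cis t)) (at_left 1)"
      by (rule isCont_tendsto_compose)
    then show ?thesis
      unfolding boundary_fun_def by (intro tendsto_Lim) auto
  qed
  have "orlicz_modular Psi (\<lambda>t. test_fun l s (cis t) / of_real 1) \<le> 1"
  proof -
    have "Psi (norm (test_fun l s (cis t))) \<le> poisson (of_real q * cis s) t" for t
    proof -
      have "cis s * den (cis t) = cis s - of_real q * cis t"
        by (simp add: den_def algebra_simps cis_mult)
      then have nd: "norm (den (cis t)) = norm (cis s - of_real q * cis t)"
        by (metis norm_mult norm_cis mult_1)
      have "den (cis t) \<noteq> 0" using q by (intro nz) (auto simp: field_simps)
      then have d0: "norm (den (cis t)) > 0" by simp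
      have "Psi (norm (test_fun l s (cis t))) \<le> (l / norm (den (cis t)))\<^sup>2 * Psi y"
        unfolding norm_f using u[of "cis t"] y by (intro Psi_scale_le) auto
      also have "\<dots> = l * 1 / (norm (den (cis t)))\<^sup>2"
        using l by (simp add: y power2_eq_square)
      \<comment> \<open>The harmless factor \<open>1 + q\<close> completes l = 1 - q to the Poisson
        numerator \<open>1 - q^2\<close>.\<close>
      also have "\<dots> \<le> l * (1 + q) / (norm (den (cis t)))\<^sup>2"
        using l q by (intro divide_right_mono mult_left_mono) auto
      also have "l * (1 + q) = 1 - q\<^sup>2" by (simp add: q_def power2_eq_square algebra_simps)
      also have "(1 - q\<^sup>2) / (norm (den (cis t)))\<^sup>2 = poisson (of_real q * cis t) s"
        using q by (simp add: poisson_def nd norm_mult)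
      finally show ?thesis by (simp only: poisson_shift)
    qed
    then have "orlicz_modular Psi (\<lambda>t. test_fun l s (cis t) / of_real 1) \<le> (\<integral>\<^sup>+t. ennreal (poisson (of_real q * cis s) t) \<partial>circ_meas)"
      unfolding orlicz_modular_def by (intro nn_integral_mono ennreal_leI) simp
    also have "\<dots> = 1" using q by (intro nn_integral_poisson) (auto simp: norm_mult)
    finally show ?thesis .
  qed
  then have 1: "in_LPsi Psi (boundary_fun (test_fun l s))" "lux_norm Psi (boundary_fun (test_fun l s)) \<le> 1"
  proof -
    assume m: "orlicz_modular Psi (\<lambda>t. test_fun l s (cis t) / of_real 1) \<le> 1"
    have "boundary_fun (test_fun l s) \<in> borel_measurable circ_meas"
      using boundary_fun_measurable[OF hol1] by simp
    with m show "in_LPsi Psi (boundary_fun (test_fun l s))"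
      unfolding in_LPsi_def bf by (intro conjI exI[of _ 1]) auto
    from m show "lux_norm Psi (boundary_fun (test_fun l s)) \<le> 1"
      by (intro lux_norm_le) (simp_all add: bf)
  qed
  \<comment> \<open>Membership asks only for some uniform bound on interior circles, so the crude
    constant 1/l is enough: the modulus is at most y, and
    \<open>Psi (l * y) \<le> l * Psi y = 1\<close>.\<close>
  have m: "orlicz_modular Psi (\<lambda>t. test_fun l s (of_real r * cis t) / of_real (1/l)) \<le> 1"
    if r: "r \<in> {0<..<1}" for r
  proof -
    have "Psi (norm (test_fun l s (of_real r * cis t) / of_real (1/l))) \<le> 1" for t
    proof -
      have "(l / norm (den (of_real r * cis t)))\<^sup>2 * y * l \<le> 1 * y * l"
        using u[of "of_real r * cis t"] r y l by (intro mult_right_mono) (auto simp: norm_mult)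
      then have "norm (test_fun l s (of_real r * cis t) / of_real (1/l)) \<le> l * y"
        using l by (simp add: norm_divide norm_f norm_mult mult.commute)
      then have "Psi (norm (test_fun l s (of_real r * cis t) / of_real (1/l))) \<le> Psi (l * y)"
        by (intro Psi_mono) auto
      also have "\<dots> \<le> l * Psi y" using l y by (intro Psi_scale_le) auto
      finally show ?thesis using l y by simp
    qed
    then have "orlicz_modular Psi (\<lambda>t. test_fun l s (of_real r * cis t) / of_real (1/l)) \<le> (\<integral>\<^sup>+t. 1 \<partial>circ_meas)"
      unfolding orlicz_modular_def by (intro nn_integral_mono) simp
    then show ?thesis by (simp add: emeasure_circ_UNIV)
  qed
  have "in_HPsi Psi (test_fun l s)"
    unfolding in_HPsi_def
  proof (intro conjI hol1 exI[of _ "1/l"] ballI)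
    fix r :: real assume r: "r \<in> {0<..<1}"
    have "(\<lambda>t. test_fun l s (of_real r * cis t)) \<in> borel_measurable borel"
      using r by (intro borel_measurable_continuous_onI continuous_on_circle hol1) auto
    then show "in_LPsi Psi (\<lambda>t. test_fun l s (of_real r * cis t))"
      unfolding in_LPsi_def using m[OF r] l by (intro conjI exI[of _ "1/l"]) auto
    show "lux_norm Psi (\<lambda>t. test_fun l s (of_real r * cis t)) \<le> 1/l"
      using m[OF r] l by (intro lux_norm_le) auto
  qed
  with 1 show "test_fun l s \<in> HPsi_unit_ball Psi" by (simp add: HPsi_unit_ball_def)
qed

text \<open>Rational directions allow one null set for all test functions at this l. At a direction
  within l of that of the boundary value w, the denominator is at most 3 l: l from the angle and 2 l
  from the modulus.\<close>

lemma order_bounded_lower: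
  assumes phi: "phi holomorphic_on ball 0 1" "phi ` ball 0 1 \<subseteq> ball 0 1"
    and g: "\<And>f. f \<in> HPsi_unit_ball Psi \<Longrightarrow> AE t in circ_meas. norm (boundary_fun (f \<circ> phi) t) \<le> g t"
    and l: "0 < l" "l < 1"
  shows "AE t in circ_meas. 1 - norm (boundary_fun phi t) < l \<longrightarrow> Inv (1 / l) / 9 \<le> g t"
proof -
  have "AE t in circ_meas. \<forall>s\<in>\<rat>. norm (boundary_fun (test_fun l s \<circ> phi) t) \<le> g t"
    using l by (subst AE_ball_countable[OF countable_rat]) (auto intro!: g test_fun_in_unit_ball)
  with self_map_radial_limit[OF phi] show ?thesis
  proof eventually_elim
    case (elim t)
    define w where "w = boundary_fun phi t"
    have w1: "norm w \<le> 1" unfolding w_def by (rule radial_limit_norm_le_1[OF phi(2) elim(1)])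
    show ?case
    proof
      assume "1 - norm (boundary_fun phi t) < l"
      then have wl: "1 - l < norm w" by (simp add: w_def)
      have "isCont cis (Arg w)" by (simp add: isCont_def tendsto_intros)
      then obtain \<delta> where \<delta>: "\<delta> > 0" "\<And>s. dist s (Arg w) < \<delta> \<Longrightarrow> dist (cis s) (cis (Arg w)) < l"
        using l unfolding continuous_at_eps_delta by (metis dist_norm)
      obtain s where s: "s \<in> \<rat>" "Arg w < s" "s < Arg w + \<delta>"
        using Rats_dense_in_real[of "Arg w" "Arg w + \<delta>"] \<delta> by auto
      then have sw: "norm (cis s - cis (Arg w)) < l"
        using \<delta>(2)[of s] by (simp add: dist_norm)
      have "continuous_on (ball 0 (1 / (1 - l))) (test_fun l s)"
        by (intro holomorphic_on_imp_continuous_on holomorphic_test_fun l)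
      moreover have "1 < 1 / (1 - l)" using l by (simp add: field_simps)
      then have "w \<in> ball 0 (1 / (1 - l))" using w1 by simp
      ultimately have "isCont (test_fun l s) w"
        by (simp add: continuous_on_eq_continuous_at)
      from boundary_fun_compose[OF elim(1)[folded w_def] this] elim(2) s(1)
      have gt: "norm (test_fun l s w) \<le> g t" by auto
      define q where "q = 1 - l"
      have q: "0 < q" "q < 1" using l by (auto simp: q_def)
      define D where "D = norm (1 - of_real q * cis (- s) * w)"
      have "cis s * (1 - of_real q * cis (- s) * w) = cis s - of_real q * w"
        by (simp add: algebra_simps cis_mult)
      then have "D = norm (cis s - of_real q * w)"
        unfolding D_def by (metis norm_mult norm_cis mult_1)
      also have "w = of_real (norm w) * cis (Arg w)"
        using rcis_cmod_Arg[of w] by (simp add: rcis_def)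
      also have "cis s - of_real q * (of_real (norm w) * cis (Arg w))
         = (cis s - cis (Arg w)) + of_real (1 - q * norm w) * cis (Arg w)"
        by (simp add: algebra_simps)
      also have "norm \<dots> \<le> norm (cis s - cis (Arg w)) + norm (of_real (1 - q * norm w) * cis (Arg w))"
        by (rule norm_triangle_ineq)
      also have "norm (of_real (1 - q * norm w) * cis (Arg w)) = \<bar>1 - q * norm w\<bar>"
        unfolding norm_mult by (simp only: norm_of_real norm_cis mult_1_right)
      also have "\<bar>1 - q * norm w\<bar> = 1 - q * norm w"
        using mult_le_one[of q "norm w"] q w1 by simp
      \<comment> \<open>This is where the membership \<open>1 - norm w < l\<close>, that is
        \<open>q < norm w\<close>, enters.\<close>
      also have "1 - q * norm w \<le> 1 - q * q"
        using wl q by (simp add: q_def[symmetric] mult_left_mono less_imp_le)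
      also have "1 - q * q \<le> 2 * l" by (simp add: q_def algebra_simps)
      finally have D3: "D \<le> 3 * l" using sw by simp
      have "D > 0"
      proof -
        have "q * norm w \<le> q * 1" using q w1 by (intro mult_left_mono) auto
        then have "q * norm w < 1" using q by linarith
        moreover have "1 - norm (of_real q * cis (-s) * w) \<le> D"
          unfolding D_def using norm_triangle_ineq2[of 1 "of_real q * cis (-s) * w"] by simp
        moreover have "norm (of_real q * cis (-s) * w) = q * norm w"
          using q by (simp add: norm_mult)
        ultimately show ?thesis by linarith
      qed
      have "1 / 3 \<le> l / D" using D3 \<open>D > 0\<close> by (simp add: field_simps)
      then have "(1 / 3)\<^sup>2 \<le> (l / D)\<^sup>2" by (intro power_mono) auto
      then have "Inv (1 / l) * (1 / 9) \<le> Inv (1 / l) * (l / D)\<^sup>2"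
        using l by (intro mult_left_mono Inv_nonneg) (auto simp: power_divide)
      also have "\<dots> = norm (test_fun l s w)"
        using l Inv_nonneg[of "1 / l"]
        by (simp add: test_fun_def D_def q_def norm_mult norm_power norm_divide)
      finally show "Inv (1 / l) / 9 \<le> g t" using gt by simp
    qed
  qed
qed

text \<open>Markov's inequality at level \<open>chi Psi A (1 / l)\<close>; the factor 9 undoes the
  loss in the lower bound for \<open>g\<close>. The parameter A serves both cases: an L-type
  majorant with constant C allows A = 1 / (9 C), an M-type majorant allows every A.\<close>

lemma carleson_of_dominated:
  assumes phi: "phi holomorphic_on ball 0 1" "phi ` ball 0 1 \<subseteq> ball 0 1"
    and g: "\<And>f. f \<in> HPsi_unit_ball Psi \<Longrightarrow> AE t in circ_meas. norm (boundary_fun (f \<circ> phi) t) \<le> g t"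
    and [measurable]: "g \<in> borel_measurable borel" and g0: "\<And>t. 0 \<le> g t"
    and A: "A > 0" and V: "(\<integral>\<^sup>+t. ennreal (Psi (9 * A * g t)) \<partial>circ_meas) \<noteq> \<infinity>"
  shows "carleson_cond Psi phi A"
proof -
  obtain v where v: "v \<ge> 0" "(\<integral>\<^sup>+t. ennreal (Psi (9 * A * g t)) \<partial>circ_meas) = ennreal v"
    using V by (cases "\<integral>\<^sup>+t. ennreal (Psi (9 * A * g t)) \<partial>circ_meas" rule: ennreal_cases) auto
  have [measurable]: "(\<lambda>t. Psi (9 * A * g t)) \<in> borel_measurable borel"
    using A g0 by (intro Psi_measurable) auto
  have main: "measure circ_meas {t. 1 - norm (boundary_fun phi t) < l} \<le> v * (1 / chi Psi A (1 / l))"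
    "0 < chi Psi A (1 / l)" if l: "0 < l" "l < 1" for l
  proof -
    have lower: "AE t in circ_meas. 1 - norm (boundary_fun phi t) < l \<longrightarrow> Inv (1 / l) / 9 \<le> g t"
      by (rule order_bounded_lower[OF phi g l])
    define c where "c = chi Psi A (1 / l)"
    have c: "c = Psi (A * Inv (1 / l))" by (simp add: c_def chi_def)
    have c0: "c > 0" unfolding c using A l by (intro Psi_pos mult_pos_pos Inv_pos) auto
    then show "0 < chi Psi A (1 / l)" by (simp add: c_def)
    define S where "S = {t. c \<le> Psi (9 * A * g t)}"
    have [measurable]: "S \<in> sets borel" unfolding S_def by measurable
    have "measure circ_meas {t. 1 - norm (boundary_fun phi t) < l} \<le> measure circ_meas S"
    proof (rule circ.finite_measure_mono_AE)
      show "AE t in circ_meas. t \<in> {t. 1 - norm (boundary_fun phi t) < l} \<longrightarrow> t \<in> S"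
        using lower
      proof eventually_elim
        case (elim t)
        show ?case
        proof
          assume "t \<in> {t. 1 - norm (boundary_fun phi t) < l}"
          then have "Inv (1 / l) / 9 \<le> g t" using elim by simp
          then have "A * Inv (1 / l) \<le> 9 * A * g t" using A by simp
          then show "t \<in> S" unfolding S_def c
            using A l by (auto intro!: Psi_mono mult_nonneg_nonneg Inv_nonneg)
        qed
      qed
    qed simp
    moreover have "c * measure circ_meas S \<le> v"
    proof -
      have "ennreal (c * measure circ_meas S) = ennreal c * emeasure circ_meas S"
        using c0 by (simp add: circ.emeasure_eq_measure ennreal_mult)
      also have "\<dots> = (\<integral>\<^sup>+t. ennreal c * indicator S t \<partial>circ_meas)"
        by (simp add: nn_integral_cmult_indicator)
      also have "\<dots> \<le> (\<integral>\<^sup>+t. ennreal (Psi (9 * A * g t)) \<partial>circ_meas)"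
        by (intro nn_integral_mono) (auto simp: S_def indicator_def intro: ennreal_leI)
      finally show ?thesis using v by simp
    qed
    ultimately show "measure circ_meas {t. 1 - norm (boundary_fun phi t) < l} \<le> v * (1 / chi Psi A (1 / l))"
      using c0 unfolding c_def[symmetric] by (simp add: field_simps) (meson mult_left_mono less_imp_le order_trans)
  qed
  show ?thesis
    unfolding carleson_cond_def
  proof (rule bigoI)
    show "\<forall>\<^sub>F l in at_right 0. norm (measure circ_meas {t. 1 - norm (boundary_fun phi t) < l})
        \<le> v * norm (1 / chi Psi A (1 / l))"
      using eventually_at_right_real[OF zero_less_one]
    proof eventually_elim
      case (elim l)
      with main[of l] show ?case by simp
    qed
  qed
qed

lemma carleson_of_order_bounded:
  assumes phi: "phi holomorphic_on ball 0 1" "phi ` ball 0 1 \<subseteq> ball 0 1"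
    and "order_bounded Psi phi"
  shows "\<exists>A>0. carleson_cond Psi phi A"
proof -
  obtain g where g: "\<And>t. g t \<ge> 0" "in_LPsi Psi (\<lambda>t. of_real (g t))"
     "\<And>f. f \<in> HPsi_unit_ball Psi \<Longrightarrow> AE t in circ_meas. norm (boundary_fun (f \<circ> phi) t) \<le> g t"
    using assms(3) unfolding order_bounded_def by blast
  obtain C where m: "(\<lambda>t. complex_of_real (g t)) \<in> borel_measurable borel"
    and C: "C > 0" "orlicz_modular Psi (\<lambda>t. of_real (g t) / of_real C) \<le> 1"
    using g(2) by (auto simp: in_LPsi_def)
  have "(\<lambda>t. norm (complex_of_real (g t))) \<in> borel_measurable borel" using m by measurable
  then have "g \<in> borel_measurable borel" using g(1) by simp
  moreover have "(\<integral>\<^sup>+t. ennreal (Psi (9 * (1 / (9 * C)) * g t)) \<partial>circ_meas) \<noteq> \<infinity>"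
    using C g(1) by (auto simp: orlicz_modular_def norm_divide top_unique)
  ultimately have "carleson_cond Psi phi (1 / (9 * C))"
    using g C by (intro carleson_of_dominated[OF phi g(3)]) auto
  then show ?thesis using C by (intro exI[of _ "1 / (9 * C)"]) auto
qed

lemma carleson_of_order_bounded_M:
  assumes phi: "phi holomorphic_on ball 0 1" "phi ` ball 0 1 \<subseteq> ball 0 1"
    and "order_bounded_M Psi phi" and A: "A > 0"
  shows "carleson_cond Psi phi A"
proof -
  obtain g where g: "\<And>t. g t \<ge> 0" "in_MPsi Psi (\<lambda>t. of_real (g t))"
     "\<And>f. f \<in> HPsi_unit_ball Psi \<Longrightarrow> AE t in circ_meas. norm (boundary_fun (f \<circ> phi) t) \<le> g t"
    using assms(3) unfolding order_bounded_M_def by blast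
  have m: "(\<lambda>t. complex_of_real (g t)) \<in> borel_measurable borel"
    using g(2) by (simp add: in_MPsi_def cong: measurable_cong_sets)
  have "1 / (9 * A) > 0" using A by simp
  then have C: "orlicz_modular Psi (\<lambda>t. of_real (g t) / of_real (1 / (9 * A))) < \<infinity>"
    using g(2) unfolding in_MPsi_def by blast
  have "(\<lambda>t. norm (complex_of_real (g t))) \<in> borel_measurable borel" using m by measurable
  then have "g \<in> borel_measurable borel" using g(1) by simp
  moreover have "(\<integral>\<^sup>+t. ennreal (Psi (9 * A * g t)) \<partial>circ_meas) \<noteq> \<infinity>"
    using C g(1) A by (auto simp: orlicz_modular_def norm_divide norm_mult mult_ac)
  ultimately show ?thesis
    using g A by (intro carleson_of_dominated[OF phi g(3)]) auto
qed

end

section \<open>Sufficiency\<close>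

context orlicz
begin

text \<open>The value 0 where the modulus is at least 1 is only a default; under a Carleson-type
  condition with positive A these angles form a null set.\<close>

definition envelope :: "(complex \<Rightarrow> complex) \<Rightarrow> real \<Rightarrow> real" where
  "envelope phi t = (if norm (boundary_fun phi t) < 1 then Inv (1 / (1 - norm (boundary_fun phi t))) else 0)"

lemma envelope_nonneg: "0 \<le> envelope phi t"
  by (simp add: envelope_def Inv_nonneg)

lemma envelope_measurable:
  assumes "phi holomorphic_on ball 0 1"
  shows "envelope phi \<in> borel_measurable borel"
proof -
  have [measurable]: "boundary_fun phi \<in> borel_measurable borel"
    by (rule boundary_fun_measurable[OF assms])
  have "(\<lambda>t. Inv (max 0 (1 / (1 - norm (boundary_fun phi t))))) \<in> borel_measurable borel"
    by (intro Inv_measurable) auto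
  moreover have "envelope phi = (\<lambda>t. if norm (boundary_fun phi t) < 1
      then Inv (max 0 (1 / (1 - norm (boundary_fun phi t)))) else 0)"
    by (auto simp: envelope_def max_absorb2)
  ultimately show ?thesis by simp
qed

text \<open>The substitution \<open>l = 1 / Psi x\<close> removes the inverse function:
  \<open>chi Psi A (1 / l)\<close> becomes \<open>Psi (A * x)\<close>.\<close>

lemma carleson_tail:
  assumes "carleson_cond Psi phi A" "A > 0"
  shows "\<exists>K\<ge>0. \<exists>x0>0. \<forall>x\<ge>x0.
    measure circ_meas {t. 1 - norm (boundary_fun phi t) < 1 / Psi x} \<le> K / Psi (A * x)"
proof -
  obtain K where K: "K > 0" "\<forall>\<^sub>F l in at_right 0. norm (measure circ_meas {t. 1 - norm (boundary_fun phi t) < l})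
     \<le> K * norm (1 / chi Psi A (1 / l))"
    using assms(1) unfolding carleson_cond_def by (elim landau_o.bigE) auto
  then obtain d where d: "d > 0" "\<And>l. 0 < l \<Longrightarrow> l < d \<Longrightarrow>
     norm (measure circ_meas {t. 1 - norm (boundary_fun phi t) < l}) \<le> K * norm (1 / chi Psi A (1 / l))"
    unfolding eventually_at_right_field by auto
  have "\<forall>\<^sub>F x in at_top. Psi x > 1 / d"
    using Psi_at_top by (simp add: filterlim_at_top_dense)
  then obtain x1 where x1: "\<And>x. x \<ge> x1 \<Longrightarrow> Psi x > 1 / d"
    by (auto simp: eventually_at_top_linorder)
  have "measure circ_meas {t. 1 - norm (boundary_fun phi t) < 1 / Psi x} \<le> K / Psi (A * x)"
    if x: "x \<ge> max x1 1" for x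
  proof -
    have P: "Psi x > 0" "Psi (A * x) > 0" using x assms(2) by (auto intro!: Psi_pos)
    have "1 / Psi x < d" using x1[of x] x d(1) P by (simp add: field_simps)
    moreover have "Inv (Psi x) = x" using x by (intro the_inv_into_f_f Psi_inj) auto
    ultimately show ?thesis using d(2)[of "1 / Psi x"] P by (simp add: chi_def)
  qed
  then show ?thesis using K by (intro exI[of _ K] conjI exI[of _ "max x1 1"]) auto
qed

text \<open>The angles with modulus at least 1 lie in the Carleson set at every scale, and
  \<open>K / Psi (A * x)\<close> tends to 0. Almost all boundary values of \<open>phi\<close> are
  thus interior points, where f is continuous.\<close>

lemma carleson_boundary_less_1:
  assumes phi: "phi holomorphic_on ball 0 1" and car: "carleson_cond Psi phi A" and A: "A > 0"
  shows "AE t in circ_meas. norm (boundary_fun phi t) < 1"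
proof -
  have [measurable]: "boundary_fun phi \<in> borel_measurable borel"
    by (rule boundary_fun_measurable[OF phi])
  obtain K x0 where K: "K \<ge> 0" "x0 > 0" "\<And>x. x \<ge> x0 \<Longrightarrow>
    measure circ_meas {t. 1 - norm (boundary_fun phi t) < 1 / Psi x} \<le> K / Psi (A * x)"
    using carleson_tail[OF car A] by auto
  let ?S = "{t. norm (boundary_fun phi t) \<ge> 1}"
  have "measure circ_meas ?S \<le> 0"
  proof (rule tendsto_lowerbound)
    have "filterlim (\<lambda>x. Psi (A * x)) at_top at_top"
      using A by (intro filterlim_compose[OF Psi_at_top] filterlim_tendsto_pos_mult_at_top[OF tendsto_const] filterlim_ident)
    then show "((\<lambda>x. K / Psi (A * x)) \<longlongrightarrow> 0) at_top"
      by (intro tendsto_divide_0[OF tendsto_const] filterlim_at_top_imp_at_infinity)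
    show "\<forall>\<^sub>F x in at_top. measure circ_meas ?S \<le> K / Psi (A * x)"
      using eventually_ge_at_top[of x0]
    proof eventually_elim
      case (elim x)
      have "0 < 1 / Psi x" using elim K(2) Psi_pos[of x] by simp
      then have "measure circ_meas ?S \<le> measure circ_meas {t. 1 - norm (boundary_fun phi t) < 1 / Psi x}"
        by (intro circ.finite_measure_mono) (auto intro: le_less_trans[of _ 0])
      also have "\<dots> \<le> K / Psi (A * x)" by (rule K(3)[OF elim])
      finally show ?case .
    qed
  qed auto
  then have "emeasure circ_meas ?S = 0"
    by (simp add: circ.emeasure_eq_measure measure_le_0_iff)
  then have "?S \<in> null_sets circ_meas" by auto
  then show ?thesis by (rule AE_I') auto
qed

text \<open>The tail bound \<open>K / Psi (A * x)\<close> alone leaves a dyadic sum of bounded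
  terms; shrinking the scale from A to A / (2 b) pays for one dyadic step (the 2) and one use of
  \<open>Delta1\<close> (the b).\<close>

lemma envelope_integral_finite:
  assumes phi: "phi holomorphic_on ball 0 1" and car: "carleson_cond Psi phi A" and A: "A > 0"
    and b: "b > 1" and D: "\<forall>\<^sub>F x in at_top. x * Psi x \<le> Psi (b * x)"
  shows "(\<integral>\<^sup>+t. ennreal (Psi (A / (2 * b) * envelope phi t)) \<partial>circ_meas) < \<infinity>"
proof -
  define c where "c = A / (2 * b)"
  have c: "c > 0" using A b by (simp add: c_def)
  define X where "X = envelope phi"
  have [measurable]: "X \<in> borel_measurable borel" unfolding X_def by (rule envelope_measurable[OF phi])
  have [measurable]: "boundary_fun phi \<in> borel_measurable borel"
    by (rule boundary_fun_measurable[OF phi])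
  have X0: "0 \<le> X t" for t by (simp add: X_def envelope_nonneg)
  obtain K x0 where K: "K \<ge> 0" "x0 > 0" "\<And>x. x \<ge> x0 \<Longrightarrow>
    measure circ_meas {t. 1 - norm (boundary_fun phi t) < 1 / Psi x} \<le> K / Psi (A * x)"
    using carleson_tail[OF car A] by auto
  obtain x1 where x1: "\<And>x. x \<ge> x1 \<Longrightarrow> x * Psi x \<le> Psi (b * x)"
    using D by (auto simp: eventually_at_top_linorder)
  \<comment> \<open>The start is large enough for the tail estimate at \<open>p n\<close> and for
    \<open>Delta1\<close> at \<open>c * p (Suc n)\<close>.\<close>
  obtain N where N: "max x0 (x1 / c) < 2 ^ N"
    using real_arch_pow[of 2 "max x0 (x1 / c)"] by auto
  define p :: "nat \<Rightarrow> real" where "p n = 2 ^ (N + n)" for n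
  have p0: "0 < p n" for n by (simp add: p_def)
  have pN: "p n \<ge> 2 ^ N" for n by (simp add: p_def)
  have pS: "p (Suc n) = 2 * p n" for n by (simp add: p_def)
  have tail: "emeasure circ_meas {t. p n < X t} \<le> ennreal (K / Psi (A * p n))" for n
  proof -
    have "{t. p n < X t} \<subseteq> {t. 1 - norm (boundary_fun phi t) < 1 / Psi (p n)}"
    proof
      fix t assume t: "t \<in> {t. p n < X t}"
      define w where "w = norm (boundary_fun phi t)"
      have w: "w < 1" using t p0[of n] by (auto simp: X_def envelope_def w_def split: if_splits)
      then have "p n < Inv (1 / (1 - w))" using t by (simp add: X_def envelope_def w_def)
      then have "Psi (p n) < 1 / (1 - w)" using w p0[of n] by (simp add: less_Inv_iff)
      then show "t \<in> {t. 1 - norm (boundary_fun phi t) < 1 / Psi (p n)}"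
        using w Psi_pos[OF p0[of n]] by (simp add: w_def[symmetric] field_simps)
    qed
    then have "measure circ_meas {t. p n < X t} \<le> measure circ_meas {t. 1 - norm (boundary_fun phi t) < 1 / Psi (p n)}"
      by (intro circ.finite_measure_mono) auto
    also have "\<dots> \<le> K / Psi (A * p n)" using N pN[of n] by (intro K(3)) auto
    finally show ?thesis by (simp add: circ.emeasure_eq_measure ennreal_leI)
  qed
  \<comment> \<open>With v = \<open>c * p (Suc n)\<close>, \<open>Delta1\<close> bounds
    \<open>Psi (A * p n)\<close> below by \<open>v * Psi v\<close>; \<open>Psi v\<close> cancels and
    K / v decays geometrically.\<close>
  have term_le: "ennreal (Psi (c * p (Suc n))) * emeasure circ_meas {t. p n < X t} \<le> ennreal (K / c * (1/2) ^ n)" for n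
  proof -
    define v where "v = c * p (Suc n)"
    have "x1 / c < p (Suc n)" using N pN[of "Suc n"] by simp
    then have v: "x1 \<le> v" "0 < v" using c p0[of "Suc n"] by (auto simp: v_def field_simps)
    have bv: "b * v = A * p n" using b by (simp add: v_def pS c_def)
    have Pv: "0 < Psi v" using v by (simp add: Psi_pos)
    have "Psi v * (K / Psi (A * p n)) \<le> Psi v * (K / (v * Psi v))"
      unfolding bv[symmetric] using x1[OF v(1)] v Pv K(1)
      by (intro mult_left_mono divide_left_mono mult_pos_pos Psi_pos) (use b in auto)
    also have "\<dots> = K / v" using Pv by simp
    also have "\<dots> \<le> K / c * (1/2) ^ n"
    proof -
      have "(2::real) ^ n \<le> p (Suc n)" unfolding p_def by (intro power_increasing) auto
      then have "K / p (Suc n) \<le> K / 2 ^ n" using K(1) by (intro divide_left_mono mult_pos_pos p0) auto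
      then have "1 / c * (K / p (Suc n)) \<le> 1 / c * (K / 2 ^ n)" using c by (intro mult_left_mono) auto
      then show ?thesis by (simp add: v_def power_divide)
    qed
    finally have *: "Psi v * (K / Psi (A * p n)) \<le> K / c * (1/2) ^ n" .
    have "ennreal (Psi v) * emeasure circ_meas {t. p n < X t} \<le> ennreal (Psi v) * ennreal (K / Psi (A * p n))"
      by (intro mult_left_mono tail) simp
    also have "\<dots> = ennreal (Psi v * (K / Psi (A * p n)))"
      using Pv K(1) Psi_pos[of "A * p n"] A p0[of n] by (intro ennreal_mult[symmetric]) auto
    also have "\<dots> \<le> ennreal (K / c * (1/2) ^ n)" by (intro ennreal_leI *)
    finally show ?thesis by (simp add: v_def)
  qed
  \<comment> \<open>Dyadic decomposition; \<open>b * (c * p (Suc n)) = A * p n\<close>, so \<open>\<Delta>\<^sup>1\<close> makes the terms geometric.\<close>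
  have pt: "ennreal (Psi (c * X t)) \<le> ennreal (Psi (c * 2 ^ N))
      + (\<Sum>n. ennreal (Psi (c * p (Suc n))) * indicator {t. p n < X t} t)" for t
  proof (cases "X t \<le> 2 ^ N")
    case True
    then have "Psi (c * X t) \<le> Psi (c * 2 ^ N)" using c X0 by (intro Psi_mono) auto
    then show ?thesis by (intro add_increasing2) (auto intro: ennreal_leI)
  next
    case False
    obtain m where m: "X t < 2 ^ m" using real_arch_pow[of 2 "X t"] by auto
    have "(2::real) ^ m \<le> p m" unfolding p_def by (intro power_increasing) auto
    with m have ex: "X t \<le> p m" by simp
    define k where "k = (LEAST k. X t \<le> p k)"
    have k: "X t \<le> p k" unfolding k_def using ex by (rule LeastI)
    have "k \<noteq> 0" using k False by (auto simp: p_def intro: ccontr)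
    then obtain n where n: "k = Suc n" by (cases k) auto
    have "p n < X t" using not_less_Least[of n "\<lambda>k. X t \<le> p k"] n unfolding k_def[symmetric] by auto
    have "ennreal (Psi (c * X t)) \<le> ennreal (Psi (c * p (Suc n)))"
      using k n c X0 by (intro ennreal_leI Psi_mono) auto
    also have "\<dots> = (\<Sum>j\<in>{n}. ennreal (Psi (c * p (Suc j))) * indicator {t. p j < X t} t)"
      using \<open>p n < X t\<close> by simp
    also have "\<dots> \<le> (\<Sum>n. ennreal (Psi (c * p (Suc n))) * indicator {t. p n < X t} t)"
      by (rule sum_le_suminf) auto
    finally show ?thesis by (rule add_increasing[rotated]) simp
  qed
  have "(\<integral>\<^sup>+t. ennreal (Psi (c * X t)) \<partial>circ_meas) \<le> (\<integral>\<^sup>+t. (ennreal (Psi (c * 2 ^ N))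
      + (\<Sum>n. ennreal (Psi (c * p (Suc n))) * indicator {t. p n < X t} t)) \<partial>circ_meas)"
    using pt by (rule nn_integral_mono)
  also have "\<dots> = ennreal (Psi (c * 2 ^ N)) + (\<Sum>n. ennreal (Psi (c * p (Suc n))) * emeasure circ_meas {t. p n < X t})"
    by (subst nn_integral_add, measurable, subst nn_integral_suminf, measurable)
      (simp add: nn_integral_cmult_indicator emeasure_circ_UNIV)
  also have "\<dots> \<le> ennreal (Psi (c * 2 ^ N)) + (\<Sum>n. ennreal (K / c * (1/2) ^ n))"
    by (intro add_left_mono suminf_le term_le) auto
  also have "(\<Sum>n. ennreal (K / c * (1/2) ^ n)) = ennreal (\<Sum>n. K / c * (1/2) ^ n)"
    using K c by (intro suminf_ennreal2 summable_mult summable_geometric) auto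
  finally show ?thesis
    unfolding c_def X_def by (rule le_less_trans) (simp add: ennreal_plus[symmetric] Psi_nonneg)
qed

lemma envelope_dominates:
  assumes phi: "phi holomorphic_on ball 0 1" "phi ` ball 0 1 \<subseteq> ball 0 1"
    and D: "Delta1 Psi" and less: "AE t in circ_meas. norm (boundary_fun phi t) < 1"
    and f: "f \<in> HPsi_unit_ball Psi"
  shows "AE t in circ_meas. norm (boundary_fun (f \<circ> phi) t) \<le> 6 * envelope phi t"
  using self_map_radial_limit[OF phi] less
proof eventually_elim
  case (elim t)
  have "f holomorphic_on ball 0 1" using f by (simp add: HPsi_unit_ball_def in_HPsi_def)
  then have "continuous_on (ball 0 1) f" by (rule holomorphic_on_imp_continuous_on)
  then have "isCont f (boundary_fun phi t)"
    using elim(2) by (simp add: continuous_on_eq_continuous_at)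
  from boundary_fun_compose[OF elim(1) this]
  have "boundary_fun (f \<circ> phi) t = f (boundary_fun phi t)" .
  then show ?case
    using pointwise_bound[OF D f elim(2)] elim(2) by (simp add: envelope_def)
qed

lemma order_bounded_of_carleson:
  assumes phi: "phi holomorphic_on ball 0 1" "phi ` ball 0 1 \<subseteq> ball 0 1"
    and D: "Delta1 Psi" and A: "A > 0" and car: "carleson_cond Psi phi A"
  shows "order_bounded Psi phi"
proof -
  obtain b where b: "b > 1" "\<forall>\<^sub>F x in at_top. x * Psi x \<le> Psi (b * x)"
    using D by (auto simp: Delta1_def)
  define c where "c = A / (2 * b)"
  have c: "c > 0" using A b by (simp add: c_def)
  have [measurable]: "envelope phi \<in> borel_measurable borel" by (rule envelope_measurable[OF phi(1)])
  have "(\<integral>\<^sup>+t. ennreal (Psi (c * envelope phi t)) \<partial>circ_meas) < \<infinity>"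
    unfolding c_def by (rule envelope_integral_finite[OF phi(1) car A b])
  then obtain v where v: "v \<ge> 0" "(\<integral>\<^sup>+t. ennreal (Psi (c * envelope phi t)) \<partial>circ_meas) = ennreal v"
    by (cases "\<integral>\<^sup>+t. ennreal (Psi (c * envelope phi t)) \<partial>circ_meas" rule: ennreal_cases) auto
  \<comment> \<open>The modular is merely finite, whereas L-membership requires a value at most 1:
    convexity moves e outside \<open>Psi\<close>, and \<open>e * v \<le> 1\<close>. The constant
    \<open>C = 6 / (e * c)\<close> absorbs the 6 of the pointwise bound.\<close>
  define e where "e = 1 / (v + 1)"
  have e: "0 < e" "e \<le> 1" "e * v \<le> 1" using v by (auto simp: e_def field_simps)
  have [measurable]: "(\<lambda>t. Psi (c * envelope phi t)) \<in> borel_measurable borel"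
    using c by (intro Psi_measurable) (auto simp: envelope_nonneg)
  define C where "C = 6 / (e * c)"
  have C: "C > 0" using e c by (simp add: C_def)
  have "orlicz_modular Psi (\<lambda>t. of_real (6 * envelope phi t) / of_real C)
      \<le> (\<integral>\<^sup>+t. ennreal e * ennreal (Psi (c * envelope phi t)) \<partial>circ_meas)"
    unfolding orlicz_modular_def
  proof (rule nn_integral_mono)
    fix t
    have "norm (complex_of_real (6 * envelope phi t) / of_real C) = \<bar>6 * envelope phi t / C\<bar>"
      by (simp only: of_real_divide[symmetric] norm_of_real)
    also have "\<dots> = e * (c * envelope phi t)"
      using e c envelope_nonneg[of phi t] by (simp add: C_def)
    finally have "Psi (norm (complex_of_real (6 * envelope phi t) / of_real C)) \<le> e * Psi (c * envelope phi t)"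
      using e c envelope_nonneg[of phi t] by (simp only:) (intro Psi_scale_le, auto)
    then show "ennreal (Psi (norm (complex_of_real (6 * envelope phi t) / of_real C)))
        \<le> ennreal e * ennreal (Psi (c * envelope phi t))"
      using e c envelope_nonneg[of phi t] by (simp add: ennreal_mult[symmetric] Psi_nonneg ennreal_leI)
  qed
  also have "\<dots> = ennreal e * ennreal v"
    unfolding v(2)[symmetric] by (rule nn_integral_cmult) measurable
  also have "\<dots> = ennreal (e * v)"
    using e v(1) by (intro ennreal_mult[symmetric]) auto
  also have "\<dots> \<le> 1" using e by (simp add: ennreal_le_1)
  finally have "in_LPsi Psi (\<lambda>t. of_real (6 * envelope phi t))"
    unfolding in_LPsi_def using C by (intro conjI exI[of _ C]) auto
  then show ?thesis
    unfolding order_bounded_def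
    using envelope_dominates[OF phi D carleson_boundary_less_1[OF phi(1) car A]]
    by (intro exI[of _ "\<lambda>t. 6 * envelope phi t"]) (auto simp: envelope_nonneg)
qed

lemma order_bounded_M_of_carleson:
  assumes phi: "phi holomorphic_on ball 0 1" "phi ` ball 0 1 \<subseteq> ball 0 1"
    and D: "Delta1 Psi" and car: "\<And>A. A > 0 \<Longrightarrow> carleson_cond Psi phi A"
  shows "order_bounded_M Psi phi"
proof -
  obtain b where b: "b > 1" "\<forall>\<^sub>F x in at_top. x * Psi x \<le> Psi (b * x)"
    using D by (auto simp: Delta1_def)
  have [measurable]: "envelope phi \<in> borel_measurable borel" by (rule envelope_measurable[OF phi(1)])
  have "orlicz_modular Psi (\<lambda>t. of_real (6 * envelope phi t) / of_real C) < \<infinity>" if C: "C > 0" for C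
  proof -
    \<comment> \<open>Solves \<open>A / (2 * b) = 6 / C\<close>, so each scale C of the M-condition
      needs the hypothesis at its own A.\<close>
    define A where "A = 12 * b / C"
    have A: "A > 0" using b C by (simp add: A_def)
    have "norm (complex_of_real (6 * envelope phi t) / of_real C) = A / (2 * b) * envelope phi t" for t
    proof -
      have "norm (complex_of_real (6 * envelope phi t) / of_real C) = \<bar>6 * envelope phi t / C\<bar>"
        by (simp only: of_real_divide[symmetric] norm_of_real)
      also have "\<dots> = A / (2 * b) * envelope phi t"
        using b C envelope_nonneg[of phi t] by (simp add: A_def)
      finally show ?thesis .
    qed
    then show ?thesis
      unfolding orlicz_modular_def using envelope_integral_finite[OF phi(1) car[OF A] A b]
      by (simp only:)
  qed
  then have "in_MPsi Psi (\<lambda>t. of_real (6 * envelope phi t))"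
    unfolding in_MPsi_def by auto
  then show ?thesis
    unfolding order_bounded_M_def
    using envelope_dominates[OF phi D carleson_boundary_less_1[OF phi(1) car[OF zero_less_one] zero_less_one]]
    by (intro exI[of _ "\<lambda>t. 6 * envelope phi t"]) (auto simp: envelope_nonneg)
qed

end

theorem mainTheorem8:
  fixes Psi :: "real \<Rightarrow> real" and phi :: "complex \<Rightarrow> complex"
  assumes "orlicz_function Psi"
    and "phi holomorphic_on ball 0 1"
    and "phi ` ball 0 1 \<subseteq> ball 0 1"
  shows "(order_bounded Psi phi \<longrightarrow> (\<exists>A>0. carleson_cond Psi phi A)) \<and>
         (order_bounded_M Psi phi \<longrightarrow> (\<forall>A>0. carleson_cond Psi phi A)) \<and>
         (Delta1 Psi \<longrightarrow>
            ((\<exists>A>0. carleson_cond Psi phi A) \<longrightarrow> order_bounded Psi phi) \<and>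
            ((\<forall>A>0. carleson_cond Psi phi A) \<longrightarrow> order_bounded_M Psi phi))"
proof -
  interpret orlicz Psi by unfold_locales fact
  show ?thesis
  proof (intro conjI impI)
    show "\<exists>A>0. carleson_cond Psi phi A" if "order_bounded Psi phi"
      by (rule carleson_of_order_bounded[OF assms(2,3) that])
    show "\<forall>A>0. carleson_cond Psi phi A" if "order_bounded_M Psi phi"
      using carleson_of_order_bounded_M[OF assms(2,3) that] by blast
    show "order_bounded Psi phi" if "Delta1 Psi" "\<exists>A>0. carleson_cond Psi phi A"
      using that order_bounded_of_carleson[OF assms(2,3)] by blast
    show "order_bounded_M Psi phi" if "Delta1 Psi" "\<forall>A>0. carleson_cond Psi phi A"
      using that by (intro order_bounded_M_of_carleson[OF assms(2,3)]) auto
  qed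
qed

end
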